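(* Let $r$ and $\sigma$ be integers with $\sigma\ge 1$ and $2\le\rho=r-\sigma\le 5$, and put $s=2^{\rho-1}$, $t=2^{\sigma+1}-1$, $m_1=2^\rho-1$. Let $G_r^\sigma$ and $W_r^\sigma$ be as in the context. Then $|W_r^\sigma|=\prod_{i=1}^{\rho}2^{i-1}(2^i-1)$. Moreover: (A) $|V(G_r^\sigma)|=\prod_{i=1}^{\rho}2^{i-1}(2^{i+\sigma}-1)={r\choose\sigma}_2\prod_{i=1}^{\rho}2^{i-1}(2^i-1)$, where ${r\choose\sigma}_2=\prod_{i=1}^{\rho}\frac{2^{i+\sigma}-1}{2^i-1}$; (B) $G_r^\sigma$ is regular of degree $s\,m_1(t-1)$; (C) the diameter of $G_r^\sigma$ is at most $2r-2$. Thus the order, degree and diameter of $G_r^\sigma$ are respectively $O(2^{(r-1)^2})$, $O(2^{r-1})$ and $O(r-1)$.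
   Context: Identify the nonzero vectors of $\mathbb{F}_2^r$ with the integers $1,\dots,2^r-1$ via binary representation. An $(r,\sigma)$-ordered pencil is a tuple $v=(A_0(v),A_1(v),\dots,A_{m_1}(v))$ where $S=A_0(v)\cup\{\mathbf 0\}$ is a $\sigma$-dimensional $\mathbb{F}_2$-linear subspace of $\mathbb{F}_2^r$ and $A_1(v),\dots,A_{m_1}(v)$ is an enumeration of the $m_1$ cosets of $S$ other than $S$. The graph $\mathcal{G}_r^\sigma$ has these ordered pencils as vertices, with $v=(A_0,\dots,A_{m_1})$ and $v'=(A'_0,\dots,A'_{m_1})$ adjacent iff: (1) $T=(A_0\cap A'_0)\cup\{\mathbf 0\}$ is a linear subspace of dimension $\sigma-1$; (2) for each $1\le i\le m_1$, $A_i\cap A'_i$ is a coset of $T$ different from $T$; (3) $\bigcup_{i=0}^{m_1}(A_i\cap A'_i)\cup\{\mathbf 0\}$ is a linear subspace of dimension $r-1$. Let $v_r^\sigma$ have $A_0=\{1,\dots,2^\sigma-1\}$ and $A_i=\{i2^\sigma,\dots,(i+1)2^\sigma-1\}$ for $1\le i\le m_1$; $G_r^\sigma$ is the connected component of $\mathcal{G}_r^\sigma$ containing $v_r^\sigma$, and $W_r^\sigma=\{w\in V(G_r^\sigma): A_0(w)=A_0(v_r^\sigma)\}$. *)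

theory Defs
  imports
    "HOL-Library.Z2"
    "HOL-Library.Function_Algebras"
    "HOL-Library.Set_Algebras"
    "HOL-Library.Landau_Symbols"
    "Graph_Theory.Graph_Theory"
begin

type_synonym f2vec = "nat \<Rightarrow> bit"

definition f2_scale :: "bit \<Rightarrow> f2vec \<Rightarrow> f2vec" where
  "f2_scale c v = (\<lambda>i. c * v i)"

global_interpretation F2: vector_space f2_scale
  by unfold_locales (auto simp: f2_scale_def fun_eq_iff algebra_simps)

text \<open>
  The dimension \<open>r\<close> has to range over all naturals, so \<open>f2_space r\<close>, the space of vectors of
  length \<open>r\<close> over the field with two elements, is the set of 0-1-sequences supported on the
  indices below \<open>r\<close>. The notions \<open>F2.subspace\<close> and \<open>F2.dim\<close> are the library's.
\<close>

definition f2_space :: "nat \<Rightarrow> f2vec set" where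
  "f2_space r = {v. \<forall>i\<ge>r. v i = 0}"

text \<open>Binary representation: coordinate \<open>i\<close> is the digit of weight \<open>2 ^ i\<close>.\<close>

definition vec_of_nat :: "nat \<Rightarrow> f2vec" where
  "vec_of_nat n = (\<lambda>i. of_bool (bit n i))"

definition f2_cosets :: "nat \<Rightarrow> f2vec set \<Rightarrow> f2vec set set" where
  "f2_cosets r S = {x +o S | x. x \<in> f2_space r}"

text \<open>
  A tuple \<open>(A\<^sub>0, \<dots>, A\<^sub>m)\<close> with \<open>m = 2 ^ (r - \<sigma>) - 1\<close> is a list of length \<open>2 ^ (r - \<sigma>)\<close>.
  The entry \<open>A\<^sub>0\<close> consists of nonzero vectors.
\<close>

type_synonym pencil = "f2vec set list"

definition ordered_pencil :: "nat \<Rightarrow> nat \<Rightarrow> pencil \<Rightarrow> bool" where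
  "ordered_pencil r \<sigma> v \<longleftrightarrow>
     length v = 2 ^ (r - \<sigma>) \<and> 0 \<notin> v ! 0 \<and>
     (let S = v ! 0 \<union> {0} in
        S \<subseteq> f2_space r \<and> F2.subspace S \<and> F2.dim S = \<sigma> \<and>
        distinct (tl v) \<and> set (tl v) = f2_cosets r S - {S})"

definition pencil_adj :: "nat \<Rightarrow> nat \<Rightarrow> pencil \<Rightarrow> pencil \<Rightarrow> bool" where
  "pencil_adj r \<sigma> v w \<longleftrightarrow>
     (let m\<^sub>1 = 2 ^ (r - \<sigma>) - 1;
          T = (v ! 0 \<inter> w ! 0) \<union> {0};
          U = (\<Union>i\<in>{0..m\<^sub>1}. v ! i \<inter> w ! i) \<union> {0}
      in F2.subspace T \<and> F2.dim T = \<sigma> - 1 \<and>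
         (\<forall>i\<in>{1..m\<^sub>1}. v ! i \<inter> w ! i \<in> f2_cosets r T \<and> v ! i \<inter> w ! i \<noteq> T) \<and>
         F2.subspace U \<and> F2.dim U = r - 1)"

text \<open>As in \<open>Graph_Theory\<close>, an undirected graph is a symmetric digraph.\<close>

definition pencil_graph :: "nat \<Rightarrow> nat \<Rightarrow> (pencil, pencil \<times> pencil) pre_digraph" where
  "pencil_graph r \<sigma> = with_proj
     \<lparr>pverts = {v. ordered_pencil r \<sigma> v},
      parcs = {(v, w). ordered_pencil r \<sigma> v \<and> ordered_pencil r \<sigma> w \<and> pencil_adj r \<sigma> v w}\<rparr>"

lemma pencil_adj_sym: "pencil_adj r \<sigma> v w \<longleftrightarrow> pencil_adj r \<sigma> w v"
  by (simp add: pencil_adj_def Int_commute)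

lemma sym_digraph_pencil_graph: "wf_digraph (pencil_graph r \<sigma>)" "symmetric (pencil_graph r \<sigma>)"
  by (auto simp: wf_digraph_def pencil_graph_def symmetric_def sym_def
      pencil_adj_sym[of r \<sigma>] intro: pencil_adj_sym[THEN iffD1])

lemma pencil_adj_irrefl:
  assumes "\<sigma> \<ge> 1" and "ordered_pencil r \<sigma> v"
  shows "\<not> pencil_adj r \<sigma> v v"
  using assms by (auto simp: pencil_adj_def ordered_pencil_def Let_def)

definition base_pencil :: "nat \<Rightarrow> nat \<Rightarrow> pencil" where
  "base_pencil r \<sigma> =
     (vec_of_nat ` {1..2 ^ \<sigma> - 1}) #
     map (\<lambda>i. vec_of_nat ` {i * 2 ^ \<sigma>..(i + 1) * 2 ^ \<sigma> - 1}) [1..<2 ^ (r - \<sigma>)]"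

text \<open>By symmetry, strongly connected components are the connected components.\<close>

definition component_graph :: "nat \<Rightarrow> nat \<Rightarrow> (pencil, pencil \<times> pencil) pre_digraph" where
  "component_graph r \<sigma> =
     pencil_graph r \<sigma> \<restriction> pre_digraph.scc_of (pencil_graph r \<sigma>) (base_pencil r \<sigma>)"

definition W_set :: "nat \<Rightarrow> nat \<Rightarrow> pencil set" where
  "W_set r \<sigma> = {w \<in> verts (component_graph r \<sigma>). w ! 0 = base_pencil r \<sigma> ! 0}"

definition gauss_binomial2 :: "nat \<Rightarrow> nat \<Rightarrow> real" where
  "gauss_binomial2 r \<sigma> = (\<Prod>i=1..r - \<sigma>. (2 ^ (i + \<sigma>) - 1) / (2 ^ i - 1))"

definition regular_of_degree :: "('a, 'b) pre_digraph \<Rightarrow> nat \<Rightarrow> bool" where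
  "regular_of_degree G d \<longleftrightarrow> (\<forall>v\<in>verts G. out_degree G v = d)"

text \<open>Meaningful only for a nonempty regular graph.\<close>

definition common_degree :: "('a, 'b) pre_digraph \<Rightarrow> nat" where
  "common_degree G = (THE d. regular_of_degree G d)"

text \<open>
  With unit weights, the library's shortest-path cost \<open>\<mu>\<close> is the graph distance
  (\<open>\<infinity>\<close> when there is no walk).
\<close>

definition graph_diameter :: "('a, 'b) pre_digraph \<Rightarrow> ereal" where
  "graph_diameter G = (SUP u\<in>verts G. SUP v\<in>verts G. wf_digraph.\<mu> G (\<lambda>_. 1) u v)"

definition admissible :: "nat \<Rightarrow> nat \<Rightarrow> bool" where
  "admissible r \<sigma> \<longleftrightarrow> 1 \<le> \<sigma> \<and> 2 \<le> r - \<sigma> \<and> r - \<sigma> \<le> 5"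

end

(*
  A tuple M of \<rho> linearly independent functionals on F_2^r, i.e. a surjective linear map onto
  F_2^\<rho>, gives an ordered pencil: A_0 is its kernel without 0 and A_i its fibre over the binary
  representation of i. The base pencil arises from the projection onto the last \<rho> coordinates.
  A neighbour of such a pencil agrees with it exactly on a hyperplane, the kernel of some c, and is
  again given by a linear map, the shear M + a c (a a nonzero vector, c outside the row space of
  M); conversely every shear gives a neighbour. Counting the pairs (a, c) yields the degree.

  Replacing one row of M by a vector outside the row space is a shear. Any M is turned into any N
  row by row with at most two replacements each: if the next row N_k lies in the row space, first
  replace a row that occurs in its expansion by a vector outside the row space. Hence the component
  consists of the pencils of all independent tuples and has diameter at most 2\<rho>. The orders are
  the numbers of independent \<rho>-tuples in F_2^r and, for W, in the annihilator of the kernel.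
*)
theory Submission
  imports Defs
begin

section \<open>Vectors and functionals over the field with two elements\<close>

text \<open>Why a neighbour must be a shear: the union condition gives a hyperplane U on which both
  pencils assign the same index to every nonzero vector, while the condition on T makes the subspace
  S of the neighbour too large to fit into U. Let s be a vector of S outside U. Translation by s
  preserves every entry of the neighbour (with 0 put back into entry 0) and exchanges U with its
  complement, so the neighbour is determined off U by its values on U. This forces a = M(s), with c
  the functional whose kernel is U. Dimensions are handled by counting: a finite subspace has
  dimension d exactly if it has 2^d elements, so the size of the fibres of M decides most dimension
  conditions. The inequality \<sigma> \<ge> 1 enters the path argument as \<rho> < r, which provides
  a vector outside the row space of any tuple, and it turns the bound 2\<rho> into 2r - 2.\<close>

declare add_bit_eq_xor [simp del] mult_bit_eq_and [simp del]

lemma bit_add_self [simp]: "b + b = (0 :: bit)"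
  by (cases b) simp_all

lemma bit_add_eq_0_iff [simp]: "a + b = 0 \<longleftrightarrow> a = (b :: bit)"
  by (cases a; cases b) simp_all

lemma bit_add_eq_1_iff: "a + b = 1 \<longleftrightarrow> a \<noteq> (b :: bit)"
  by (cases a; cases b) simp_all

lemma f2_add_self [simp]: "x + x = (0 :: f2vec)"
  by (simp add: fun_eq_iff)

lemma f2_add_left_self [simp]: "x + (x + y) = (y :: f2vec)"
  by (simp flip: add.assoc)

lemma f2_add_eq_iff: "x + y = z \<longleftrightarrow> y = x + (z :: f2vec)"
  by auto

lemma f2_add_eq_0_iff [simp]: "x + y = 0 \<longleftrightarrow> x = (y :: f2vec)"
  by (metis add_0_right f2_add_eq_iff)

lemma f2_diff: "x - y = x + (y :: f2vec)"
  by (simp add: fun_eq_iff)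

text \<open>The only scalars are 0 and 1, so closure under scaling amounts to containing 0.\<close>

lemma f2_subspace_iff: "F2.subspace S \<longleftrightarrow> 0 \<in> S \<and> (\<forall>x\<in>S. \<forall>y\<in>S. x + y \<in> S)"
proof -
  have "f2_scale c x = 0 \<or> f2_scale c x = x" for c x
    by (cases c) auto
  then show ?thesis
    unfolding F2.subspace_def by metis
qed

lemma zero_in_f2_space [simp]: "0 \<in> f2_space r"
  by (simp add: f2_space_def)

lemma f2_space_add [intro]: "x \<in> f2_space r \<Longrightarrow> y \<in> f2_space r \<Longrightarrow> x + y \<in> f2_space r"
  by (simp add: f2_space_def)

lemma f2_space_mono: "m \<le> n \<Longrightarrow> f2_space m \<subseteq> f2_space n"
  by (auto simp: f2_space_def)

section \<open>Cardinality and dimension of subspaces\<close>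

lemma finite_card_f2_space: "finite (f2_space n) \<and> card (f2_space n) = 2 ^ n"
proof (induction n)
  case 0
  have "f2_space 0 = {0}" by (auto simp: f2_space_def)
  then show ?case by simp
next
  case (Suc n)
  let ?f = "\<lambda>x :: f2vec. x(n := 1)"
  have eq: "f2_space (Suc n) = f2_space n \<union> ?f ` f2_space n"
  proof (intro equalityI subsetI)
    fix x assume x: "x \<in> f2_space (Suc n)"
    show "x \<in> f2_space n \<union> ?f ` f2_space n"
    proof (cases "x n")
      case zero
      then have "x \<in> f2_space n" using x
        by (simp add: f2_space_def) (metis le_neq_implies_less Suc_leI)
      then show ?thesis by blast
    next
      case one
      then have "x = ?f (x(n := 0))" by auto
      moreover have "x(n := 0) \<in> f2_space n"
        using x by (auto simp: f2_space_def)
      ultimately show ?thesis by blast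
    qed
  qed (auto simp: f2_space_def)
  have "f2_space n \<inter> ?f ` f2_space n = {}"
    by (auto simp: f2_space_def)
  moreover have "inj_on ?f (f2_space n)"
    by (rule inj_onI) (simp add: f2_space_def fun_eq_iff, metis order_refl)
  ultimately show ?case
    using Suc by (simp add: eq card_Un_disjoint card_image)
qed

lemmas finite_f2_space [simp] = finite_card_f2_space [THEN conjunct1]
  and card_f2_space = finite_card_f2_space [THEN conjunct2]

text \<open>Adjoining a vector \<open>a\<close> outside the span adds the disjoint translate of the
  span by \<open>a\<close>, so each basis vector doubles the size.\<close>

lemma card_span_independent:
  assumes "finite B" "F2.independent B"
  shows "finite (F2.span B) \<and> card (F2.span B) = 2 ^ card B"
  using assms
proof (induction B)
  case empty
  then show ?case by simp
next
  case (insert a B)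
  have a: "a \<notin> F2.span B" and B: "F2.independent B"
    using insert by (auto simp: F2.independent_insert)
  have eq: "F2.span (insert a B) = F2.span B \<union> (+) a ` F2.span B"
  proof (intro equalityI subsetI)
    fix x assume "x \<in> F2.span (insert a B)"
    then obtain k where k: "x - f2_scale k a \<in> F2.span B"
      by (auto simp: F2.span_insert)
    show "x \<in> F2.span B \<union> (+) a ` F2.span B"
    proof (cases k)
      case zero
      then show ?thesis using k by simp
    next
      case one
      then have "a + x \<in> F2.span B" using k by (simp add: f2_diff add.commute)
      then show ?thesis by (auto intro!: image_eqI[of _ _ "a + x"])
    qed
  next
    fix x assume "x \<in> F2.span B \<union> (+) a ` F2.span B"
    then show "x \<in> F2.span (insert a B)"
      using F2.span_mono[of B "insert a B"] F2.span_base[of a "insert a B"]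
      by (auto intro!: F2.span_add)
  qed
  have "F2.span B \<inter> (+) a ` F2.span B = {}"
  proof -
    have False if "x \<in> F2.span B" "a + x \<in> F2.span B" for x
      using F2.span_add[OF that(2,1)] a by (simp add: add.assoc)
    then show ?thesis by auto
  qed
  then show ?case
    using insert B by (simp add: eq card_Un_disjoint card_image)
qed

text \<open>The dimension conditions in the definitions of pencils and adjacency are handled through
  this passage to counting.\<close>

lemma f2_dim_eq_iff:
  assumes "F2.subspace S" "finite S"
  shows "F2.dim S = d \<longleftrightarrow> card S = 2 ^ d"
proof -
  obtain B where B: "B \<subseteq> S" "F2.independent B" "S \<subseteq> F2.span B" "card B = F2.dim S"
    by (rule F2.basis_exists)
  have "S = F2.span B"
    using B assms F2.span_minimal by blast
  then have "card S = 2 ^ F2.dim S"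
    using card_span_independent[of B] B assms(2) finite_subset by metis
  then show ?thesis by simp
qed

section \<open>Functionals, row spaces and independent tuples\<close>

definition dot :: "nat \<Rightarrow> f2vec \<Rightarrow> f2vec \<Rightarrow> bit" where
  "dot r c x = (\<Sum>i<r. c i * x i)"

definition unit_vec :: "nat \<Rightarrow> f2vec" where
  "unit_vec k = (\<lambda>i. if i = k then 1 else 0)"

definition comb :: "nat \<Rightarrow> (nat \<Rightarrow> f2vec) \<Rightarrow> f2vec \<Rightarrow> f2vec" where
  "comb n M b = (\<lambda>i. \<Sum>k<n. b k * M k i)"

definition row_space :: "nat \<Rightarrow> (nat \<Rightarrow> f2vec) \<Rightarrow> f2vec set" where
  "row_space n M = range (comb n M)"

text \<open>Rows are coefficient vectors of functionals, so this is the matrix-vector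
  product.\<close>

definition app :: "nat \<Rightarrow> (nat \<Rightarrow> f2vec) \<Rightarrow> f2vec \<Rightarrow> f2vec" where
  "app r M x = (\<lambda>k. dot r (M k) x)"

definition fiber :: "nat \<Rightarrow> (nat \<Rightarrow> f2vec) \<Rightarrow> f2vec \<Rightarrow> f2vec set" where
  "fiber r M y = {x \<in> f2_space r. app r M x = y}"

text \<open>Rows from index \<open>n\<close> on are 0, so that a tuple is represented by exactly one
  function and can be counted; coefficient vectors are cut to \<open>f2_space n\<close> because
  \<open>comb\<close> ignores their other entries. The ambient set \<open>X\<close> is the whole
  space for the component and an annihilator for \<open>W_set\<close>.\<close>

definition indep_rows :: "f2vec set \<Rightarrow> nat \<Rightarrow> (nat \<Rightarrow> f2vec) set" where
  "indep_rows X n = {M. (\<forall>k<n. M k \<in> X) \<and> (\<forall>k\<ge>n. M k = 0) \<and>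
     (\<forall>b\<in>f2_space n. comb n M b = 0 \<longrightarrow> b = 0)}"

lemma dot_add [simp]:
  "dot r c (x + y) = dot r c x + dot r c y" "dot r (c + d) x = dot r c x + dot r d x"
  by (simp_all add: dot_def algebra_simps sum.distrib)

lemma dot_0 [simp]: "dot r 0 x = 0" "dot r c 0 = 0"
  by (simp_all add: dot_def)

lemma dot_f2_scale [simp]: "dot r (f2_scale a c) x = a * dot r c x"
  by (simp add: dot_def f2_scale_def sum_distrib_left mult.assoc)

lemma dot_unit_vec: "i < r \<Longrightarrow> dot r c (unit_vec i) = c i" "i < r \<Longrightarrow> dot r (unit_vec i) c = c i"
  by (simp_all add: dot_def unit_vec_def if_distrib if_distribR cong: if_cong)

lemma unit_vec_neq_0 [simp]: "unit_vec k \<noteq> 0"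
proof
  assume "unit_vec k = 0"
  then have "unit_vec k k = 0" by simp
  then show False by (simp add: unit_vec_def)
qed

lemma unit_vec_in_f2_space: "i < r \<Longrightarrow> unit_vec i \<in> f2_space r"
  by (simp add: unit_vec_def f2_space_def)

lemma comb_0 [simp]: "comb 0 M b = 0" "comb n M 0 = 0"
  by (simp_all add: comb_def fun_eq_iff)

lemma comb_add: "comb n M (b + d) = comb n M b + comb n M d"
  by (simp add: comb_def algebra_simps sum.distrib fun_eq_iff)

lemma comb_Suc: "comb (Suc n) M b = comb n M b + f2_scale (b n) (M n)"
  by (simp add: comb_def f2_scale_def fun_eq_iff)

lemma comb_cong: "(\<And>k. k < n \<Longrightarrow> b k = d k \<and> M k = N k) \<Longrightarrow> comb n M b = comb n N d"
  by (simp add: comb_def)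

lemma comb_unit_vec: "j < n \<Longrightarrow> comb n M (unit_vec j) = M j"
  by (simp add: comb_def unit_vec_def fun_eq_iff if_distrib if_distribR cong: if_cong)

lemma dot_comb: "dot r (comb n M b) x = (\<Sum>k<n. b k * dot r (M k) x)"
proof -
  have "dot r (comb n M b) x = (\<Sum>i<r. \<Sum>k<n. b k * M k i * x i)"
    by (simp add: dot_def comb_def sum_distrib_right)
  also have "\<dots> = (\<Sum>k<n. \<Sum>i<r. b k * M k i * x i)"
    by (rule sum.swap)
  finally show ?thesis by (simp add: dot_def sum_distrib_left mult.assoc)
qed

lemma row_space_add: "x \<in> row_space n M \<Longrightarrow> y \<in> row_space n M \<Longrightarrow> x + y \<in> row_space n M"
  by (auto simp: row_space_def simp flip: comb_add)

lemma row_in_row_space: "j < n \<Longrightarrow> M j \<in> row_space n M"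
  unfolding row_space_def by (metis comb_unit_vec rangeI)

lemma zero_in_row_space [simp]: "0 \<in> row_space n M"
  unfolding row_space_def by (metis comb_0(2) rangeI)

lemma row_space_0 [simp]: "row_space 0 M = {0}"
  by (auto simp: row_space_def)

text \<open>The coefficient of the last row is 0 or 1. In this form inductions on the number of rows
  need no coefficient vectors.\<close>

lemma row_space_Suc: "v \<in> row_space (Suc n) M \<longleftrightarrow> v \<in> row_space n M \<or> v + M n \<in> row_space n M"
proof
  assume "v \<in> row_space (Suc n) M"
  then obtain b where b: "v = comb n M b + f2_scale (b n) (M n)"
    by (auto simp: row_space_def comb_Suc)
  show "v \<in> row_space n M \<or> v + M n \<in> row_space n M"
    by (cases "b n") (auto simp: b row_space_def add.assoc)
next
  have *: "comb (Suc n) M (b(n := c)) = comb n M b + f2_scale c (M n)" for b c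
    using comb_cong[of n "b(n := c)" b M M] by (simp add: comb_Suc)
  assume "v \<in> row_space n M \<or> v + M n \<in> row_space n M"
  then obtain b c where "v = comb n M b + f2_scale c (M n)"
    by (auto simp: row_space_def) (metis add_0_right F2.scale_zero_left,
      metis add.commute f2_add_left_self F2.scale_one)
  then show "v \<in> row_space (Suc n) M"
    by (auto simp: row_space_def simp flip: *)
qed

lemma row_space_subset:
  assumes "F2.subspace X" "\<And>k. k < n \<Longrightarrow> M k \<in> X"
  shows "row_space n M \<subseteq> X"
  using assms(2)
proof (induction n)
  case 0
  then show ?case using assms by (simp add: f2_subspace_iff)
next
  case (Suc n)
  show ?case
  proof
    fix v assume "v \<in> row_space (Suc n) M"
    then have "v \<in> X \<or> v + M n \<in> X" using Suc by (auto simp: row_space_Suc)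
    moreover have "v = M n + (v + M n)"
      by (simp add: add.commute[of v])
    ultimately show "v \<in> X"
      using assms(1) Suc.prems[of n] by (metis f2_subspace_iff lessI)
  qed
qed

lemma subspace_f2_space: "F2.subspace (f2_space r)"
  by (auto simp: f2_subspace_iff)

text \<open>Neither \<open>c\<close> nor \<open>c + M n\<close> lies in the span of the rows before
  \<open>M n\<close>, so the induction hypothesis applies to both. This is what makes the map of an
  independent tuple surjective.\<close>

lemma exists_separating_vector:
  assumes "\<And>k. k < n \<Longrightarrow> M k \<in> f2_space r" "c \<in> f2_space r" "c \<notin> row_space n M"
  shows "\<exists>x\<in>f2_space r. (\<forall>k<n. dot r (M k) x = 0) \<and> dot r c x = 1"
  using assms
proof (induction n arbitrary: c)
  case 0
  then obtain i where i: "c i \<noteq> 0" by (auto simp: fun_eq_iff)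
  then have "i < r" using 0(2) by (auto simp: f2_space_def not_le)
  then show ?case using i
    by (intro bexI[of _ "unit_vec i"]) (auto simp: dot_unit_vec unit_vec_in_f2_space)
next
  case (Suc n)
  have M: "\<And>k. k < Suc n \<Longrightarrow> M k \<in> f2_space r" by fact
  obtain y where y: "y \<in> f2_space r" "\<forall>k<n. dot r (M k) y = 0" "dot r c y = 1"
    using Suc.IH[of c] Suc.prems by (auto simp: row_space_Suc)
  have cM: "c + M n \<in> f2_space r" "c + M n \<notin> row_space n M"
    using Suc.prems by (auto simp: row_space_Suc)
  obtain z where z: "z \<in> f2_space r" "\<forall>k<n. dot r (M k) z = 0" "dot r (c + M n) z = 1"
    using Suc.IH[OF _ cM] Suc.prems(1) by (metis less_SucI)
  \<comment> \<open>If \<open>M n\<close> vanishes at neither \<open>y\<close> nor \<open>z\<close>,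
    it vanishes at \<open>y + z\<close>; in that case \<open>c\<close> is 1 at \<open>y\<close> and
    0 at \<open>z\<close>.\<close>
  define w where "w = (if dot r (M n) y = 0 then y else if dot r (M n) z = 0 then z else y + z)"
  have "w \<in> f2_space r" using y z by (auto simp: w_def)
  moreover have "\<forall>k<Suc n. dot r (M k) w = 0" "dot r c w = 1"
    using y z by (auto simp: w_def less_Suc_eq bit_add_eq_1_iff)
  ultimately show ?case by blast
qed

text \<open>A new row preserves independence exactly if it is not a combination of the earlier ones.
  Rows can thus be chosen one after the other, for counting as well as for induction.\<close>

lemma indep_rows_Suc:
  "indep_rows X (Suc n) = (\<lambda>(M, c). M(n := c)) ` (SIGMA M:indep_rows X n. X - row_space n M)"
proof (intro equalityI subsetI)
  fix M assume M: "M \<in> indep_rows X (Suc n)"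
  define N where "N = M(n := 0)"
  have [simp]: "comb n N b = comb n M b" for b
    by (rule comb_cong) (simp add: N_def)
  have "b = 0" if "b \<in> f2_space n" "comb n N b = 0" for b
  proof -
    have "comb (Suc n) M b = 0"
      using that by (simp add: comb_Suc f2_space_def)
    then show ?thesis
      using M that f2_space_mono[of n "Suc n"] by (auto simp: indep_rows_def)
  qed
  moreover have "M n \<notin> row_space n N"
  proof
    assume "M n \<in> row_space n N"
    then obtain b where b: "M n = comb n M b" by (auto simp: row_space_def)
    \<comment> \<open>The dependence of \<open>M n\<close> on the earlier rows as one coefficient
      vector, with 1 at the new index.\<close>
    define d where "d = (\<lambda>k. if k < n then b k else if k = n then 1 else 0)"
    have "comb n M d = comb n M b" by (rule comb_cong) (simp add: d_def)
    then have "comb (Suc n) M d = 0" using b by (simp add: comb_Suc) (simp add: d_def)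
    moreover have "d \<in> f2_space (Suc n)" by (auto simp: d_def f2_space_def)
    ultimately have "d = 0" using M by (auto simp: indep_rows_def)
    then have "d n = 0" by simp
    then show False by (simp add: d_def)
  qed
  ultimately have "(N, M n) \<in> (SIGMA M:indep_rows X n. X - row_space n M)"
    using M by (auto simp: indep_rows_def N_def)
  then show "M \<in> (\<lambda>(M, c). M(n := c)) ` (SIGMA M:indep_rows X n. X - row_space n M)"
    by (rule rev_image_eqI) (simp add: N_def)
next
  fix M' assume "M' \<in> (\<lambda>(M, c). M(n := c)) ` (SIGMA M:indep_rows X n. X - row_space n M)"
  then obtain M c where M: "M \<in> indep_rows X n" "c \<in> X" "c \<notin> row_space n M" and M': "M' = M(n := c)"
    by auto
  have [simp]: "comb n M' b = comb n M b" for b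
    by (rule comb_cong) (simp add: M')
  have "b = 0" if b: "b \<in> f2_space (Suc n)" "comb (Suc n) M' b = 0" for b
  proof (cases "b n")
    case zero
    then have "b \<in> f2_space n"
      using b by (auto simp: f2_space_def) (metis le_neq_implies_less Suc_leI)
    then show ?thesis using b zero M by (auto simp: indep_rows_def comb_Suc)
  next
    case one
    then have "c = comb n M b"
      using b(2) by (simp add: comb_Suc) (simp add: M')
    then show ?thesis using M(3) by (auto simp: row_space_def)
  qed
  then show "M' \<in> indep_rows X (Suc n)"
    using M by (auto simp: indep_rows_def M' less_Suc_eq)
qed

lemma card_row_space:
  assumes "M \<in> indep_rows X n"
  shows "card (row_space n M) = 2 ^ n"
proof -
  have "row_space n M = comb n M ` f2_space n"
  proof (intro equalityI subsetI)
    fix v assume "v \<in> row_space n M"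
    then obtain b where "v = comb n M b" by (auto simp: row_space_def)
    also have "\<dots> = comb n M (\<lambda>k. if k < n then b k else 0)"
      by (rule comb_cong) simp
    finally show "v \<in> comb n M ` f2_space n" by (auto simp: f2_space_def)
  qed (auto simp: row_space_def)
  moreover have "inj_on (comb n M) (f2_space n)"
  proof (rule inj_onI)
    fix b d assume bd: "b \<in> f2_space n" "d \<in> f2_space n" "comb n M b = comb n M d"
    then have "comb n M (b + d) = 0" by (simp add: comb_add)
    then have "b + d = 0" using assms f2_space_add[OF bd(1,2)] by (auto simp: indep_rows_def)
    then show "b = d" by simp
  qed
  ultimately show ?thesis by (simp add: card_image card_f2_space)
qed

text \<open>After \<open>n\<close> rows, any vector of \<open>X\<close> outside their row space may
  follow, and that row space has \<open>2 ^ n\<close> elements, all in \<open>X\<close>.\<close>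

lemma card_indep_rows:
  assumes "F2.subspace X" "finite X"
  shows "finite (indep_rows X n) \<and> card (indep_rows X n) = (\<Prod>i<n. card X - 2 ^ i)"
proof (induction n)
  case 0
  have "indep_rows X 0 = {0}"
    by (auto simp: indep_rows_def f2_space_def fun_eq_iff)
  then show ?case by simp
next
  case (Suc n)
  have inj: "inj_on (\<lambda>(M, c). M(n := c)) (SIGMA M:indep_rows X n. X - row_space n M)"
  proof (rule inj_onI, clarify)
    fix M c N d assume *: "M \<in> indep_rows X n" "N \<in> indep_rows X n" "M(n := c) = N(n := d)"
    have "M k = N k" for k
      using fun_cong[OF *(3), of k] *(1,2) by (cases "k = n") (auto simp: indep_rows_def)
    moreover have "c = d" using fun_cong[OF *(3), of n] by simp
    ultimately show "M = N \<and> c = d" by auto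
  qed
  have "card (X - row_space n M) = card X - 2 ^ n" if M: "M \<in> indep_rows X n" for M
  proof -
    have "row_space n M \<subseteq> X"
      using row_space_subset[OF assms(1)] M by (auto simp: indep_rows_def)
    then show ?thesis
      using card_row_space[OF M] assms(2) by (simp add: card_Diff_subset finite_subset)
  qed
  then show ?case
    using Suc assms by (simp add: indep_rows_Suc card_image[OF inj])
qed

section \<open>Fibres of the linear map of a tuple\<close>

lemma app_add [simp]: "app r M (x + y) = app r M x + app r M y"
  by (simp add: app_def fun_eq_iff)

lemma app_0 [simp]: "app r M 0 = 0"
  by (simp add: app_def fun_eq_iff)

lemma app_in_f2_space: "M \<in> indep_rows X n \<Longrightarrow> app r M x \<in> f2_space n"
  by (auto simp: app_def indep_rows_def f2_space_def)

text \<open>A new row \<open>c\<close> cuts each fibre of the earlier rows into two halves,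
  exchanged by translation with a vector \<open>z\<close> on which the earlier rows vanish and
  \<open>c\<close> does not. The multiplicative form avoids the difference \<open>r - n\<close>
  until \<open>n \<le> r\<close> is known.\<close>

lemma card_fiber_mult:
  assumes "M \<in> indep_rows (f2_space r) n" "y \<in> f2_space n"
  shows "2 ^ n * card (fiber r M y) = 2 ^ r"
  using assms
proof (induction n arbitrary: M y)
  case 0
  then have "fiber r M y = f2_space r"
    by (auto simp: fiber_def app_def indep_rows_def f2_space_def dot_def fun_eq_iff)
  then show ?case by (simp add: card_f2_space)
next
  case (Suc n)
  obtain N c where N: "N \<in> indep_rows (f2_space r) n" "c \<in> f2_space r" "c \<notin> row_space n N"
    and M: "M = N(n := c)"
    using Suc.prems(1) by (auto simp: indep_rows_Suc)
  obtain z where z: "z \<in> f2_space r" "\<forall>k<n. dot r (N k) z = 0" "dot r c z = 1"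
    using exists_separating_vector[OF _ N(2,3)] N(1) by (auto simp: indep_rows_def)
  have app_z: "app r M z = unit_vec n"
  proof
    fix k show "app r M z k = unit_vec n k"
      using z N(1) by (cases "k < n") (simp_all add: M app_def unit_vec_def indep_rows_def)
  qed
  have app_M: "app r M x = (app r N x)(n := dot r c x)" for x
    by (auto simp: M app_def)
  have y0: "y(n := 0) \<in> f2_space n"
    using Suc.prems(2) by (auto simp: f2_space_def)
  have appN: "app r N x n = 0" for x
    using N(1) by (auto simp: app_def indep_rows_def)
  \<comment> \<open>Dropping the last row replaces \<open>y\<close> by \<open>y(n := 0)\<close>; the
    translate by \<open>z\<close> is the half on which \<open>c\<close> takes the value other than
    \<open>y n\<close>.\<close>
  have eq: "fiber r N (y(n := 0)) = fiber r M y \<union> (+) z ` fiber r M y" (is "?l = ?r")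
  proof (intro equalityI subsetI)
    fix x assume x: "x \<in> ?l"
    show "x \<in> ?r"
    proof (cases "dot r c x = y n")
      case True
      then show ?thesis using x by (auto simp: fiber_def app_M)
    next
      case False
      then have "1 + dot r c x = y n"
        by (cases "dot r c x"; cases "y n") auto
      then have "z + x \<in> fiber r M y"
        using x z appN
        by (auto simp: fiber_def app_z) (auto simp: app_M unit_vec_def fun_eq_iff)
      then show ?thesis by (auto intro!: image_eqI[of _ _ "z + x"])
    qed
  next
    have *: "x \<in> ?l" if "x \<in> fiber r M y" for x
    proof -
      have "(app r N x)(n := dot r c x) = y" "x \<in> f2_space r"
        using that by (simp_all add: fiber_def app_M)
      then have "y(n := 0) = app r N x"
        using appN[of x] by (metis fun_upd_triv fun_upd_upd)
      then show ?thesis using \<open>x \<in> f2_space r\<close> by (simp add: fiber_def)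
    qed
    have **: "z + x \<in> ?l" if "x \<in> ?l" for x
    proof -
      have "app r N z = 0"
        using app_z appN[of z] by (auto simp: app_M fun_eq_iff unit_vec_def) metis
      then show ?thesis using that z by (auto simp: fiber_def)
    qed
    fix x assume "x \<in> ?r"
    then show "x \<in> ?l" using * ** by auto
  qed
  have "fiber r M y \<inter> (+) z ` fiber r M y = {}"
  proof -
    have "app r M x \<noteq> app r M (z + x)" for x
      unfolding app_add app_z by (metis add_cancel_right_left unit_vec_neq_0)
    then show ?thesis by (auto simp: fiber_def simp del: app_add)
  qed
  moreover have "finite (fiber r M y)" by (simp add: fiber_def)
  ultimately have "card (fiber r N (y(n := 0))) = 2 * card (fiber r M y)"
    by (simp add: eq card_Un_disjoint card_image)
  then show ?case
    using Suc.IH[OF N(1) y0] by (metis mult.assoc power_Suc2)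
qed

section \<open>Pencils of linear maps\<close>

text \<open>Removing 0 affects entry 0 only, because no fibre over a nonzero vector contains
  0.\<close>

definition pencil_of :: "nat \<Rightarrow> nat \<Rightarrow> (nat \<Rightarrow> f2vec) \<Rightarrow> pencil" where
  "pencil_of r n M = map (\<lambda>i. fiber r M (vec_of_nat i) - {0}) [0..<2 ^ n]"

definition shear :: "(nat \<Rightarrow> f2vec) \<Rightarrow> f2vec \<Rightarrow> f2vec \<Rightarrow> nat \<Rightarrow> f2vec" where
  "shear M a c = (\<lambda>k. M k + f2_scale (a k) c)"

lemma vec_of_nat_0 [simp]: "vec_of_nat 0 = 0"
  by (simp add: vec_of_nat_def fun_eq_iff)

lemma vec_of_nat_eq_iff [simp]: "vec_of_nat i = vec_of_nat j \<longleftrightarrow> i = j"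
proof
  assume eq: "vec_of_nat i = vec_of_nat j"
  show "i = j"
  proof (rule bit_eqI)
    fix n show "bit i n \<longleftrightarrow> bit j n"
      using fun_cong[OF eq, of n] by (simp add: vec_of_nat_def of_bool_def split: if_splits)
  qed
qed simp

lemma vec_of_nat_eq_0_iff [simp]: "vec_of_nat i = 0 \<longleftrightarrow> i = 0"
  by (metis vec_of_nat_0 vec_of_nat_eq_iff)

lemma bij_betw_vec_of_nat: "bij_betw vec_of_nat {..<2 ^ n} (f2_space n)"
proof -
  have inj: "inj_on vec_of_nat {..<2 ^ n}"
    by (rule inj_onI) simp
  have sub: "vec_of_nat ` {..<2 ^ n} \<subseteq> f2_space n"
  proof clarify
    fix i :: nat assume "i < 2 ^ n"
    then have "take_bit n i = i" by (simp add: take_bit_nat_eq_self)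
    then have "bit i k \<Longrightarrow> k < n" for k by (metis bit_take_bit_iff)
    then show "vec_of_nat i \<in> f2_space n" by (force simp: f2_space_def vec_of_nat_def)
  qed
  have "vec_of_nat ` {..<2 ^ n} = f2_space n"
    by (rule card_subset_eq[OF _ sub]) (simp_all add: card_image[OF inj] card_f2_space)
  then show ?thesis using inj by (simp add: bij_betw_def)
qed

lemma vec_of_nat_in_f2_space: "i < 2 ^ n \<Longrightarrow> vec_of_nat i \<in> f2_space n"
  using bij_betw_vec_of_nat[of n] by (auto simp: bij_betw_def)

lemma f2_space_eq_vec_of_nat: "y \<in> f2_space n \<Longrightarrow> \<exists>i<2 ^ n. y = vec_of_nat i"
  using bij_betw_vec_of_nat[of n] by (auto simp: bij_betw_def)

text \<open>The product formula makes \<open>2 ^ n\<close> a divisor of \<open>2 ^ r\<close>, hence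
  \<open>n \<le> r\<close>, and \<open>r - n\<close> is a genuine difference.\<close>

lemma card_fiber:
  assumes "M \<in> indep_rows (f2_space r) n" "y \<in> f2_space n"
  shows "card (fiber r M y) = 2 ^ (r - n)"
proof -
  have eq: "2 ^ n * card (fiber r M y) = 2 ^ r" by (rule card_fiber_mult[OF assms])
  then have "(2 :: nat) ^ n dvd 2 ^ r" by (metis dvd_triv_left)
  then have "n \<le> r" by (rule power_dvd_imp_le) simp
  then have "2 ^ n * card (fiber r M y) = 2 ^ n * 2 ^ (r - n)"
    using eq by (simp flip: power_add)
  then show ?thesis by simp
qed

lemma fiber_subset: "fiber r M y \<subseteq> f2_space r"
  by (auto simp: fiber_def)

lemma finite_fiber [simp]: "finite (fiber r M y)"
  by (simp add: fiber_def)

lemma fiber_nonempty: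
  assumes "M \<in> indep_rows (f2_space r) n" "y \<in> f2_space n"
  shows "fiber r M y \<noteq> {}"
  using card_fiber[OF assms] by force

lemma zero_in_fiber_iff [simp]: "0 \<in> fiber r M y \<longleftrightarrow> y = 0"
  by (auto simp: fiber_def)

lemma inj_on_fiber:
  assumes "M \<in> indep_rows (f2_space r) n"
  shows "inj_on (fiber r M) (f2_space n)"
proof (rule inj_onI)
  fix y z assume *: "y \<in> f2_space n" "z \<in> f2_space n" "fiber r M y = fiber r M z"
  then obtain x where "x \<in> fiber r M y" using fiber_nonempty[OF assms] by blast
  with * show "y = z" by (auto simp: fiber_def)
qed

lemma subspace_fiber_0: "F2.subspace (fiber r M 0)"
  by (auto simp: f2_subspace_iff fiber_def)

lemma coset_fiber: "x \<in> f2_space r \<Longrightarrow> x +o fiber r M 0 = fiber r M (app r M x)"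
proof (intro equalityI subsetI)
  fix z assume x: "x \<in> f2_space r" and z: "z \<in> fiber r M (app r M x)"
  then have "x + z \<in> fiber r M 0" by (auto simp: fiber_def)
  then show "z \<in> x +o fiber r M 0"
    by (auto simp: elt_set_plus_def intro!: bexI[of _ "x + z"])
qed (auto simp: elt_set_plus_def fiber_def)

lemma cosets_fiber_0:
  assumes "M \<in> indep_rows (f2_space r) n"
  shows "f2_cosets r (fiber r M 0) = fiber r M ` f2_space n"
proof (intro equalityI subsetI)
  fix C assume "C \<in> f2_cosets r (fiber r M 0)"
  then show "C \<in> fiber r M ` f2_space n"
    using app_in_f2_space[OF assms] by (auto simp: f2_cosets_def coset_fiber)
next
  fix C assume "C \<in> fiber r M ` f2_space n"
  then obtain y where y: "y \<in> f2_space n" "C = fiber r M y" by blast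
  then obtain x where "x \<in> fiber r M y" using fiber_nonempty[OF assms] by blast
  then have x: "x \<in> f2_space r" "app r M x = y" by (auto simp: fiber_def)
  then have "C = x +o fiber r M 0" using y by (simp add: coset_fiber)
  then show "C \<in> f2_cosets r (fiber r M 0)" using x by (auto simp: f2_cosets_def)
qed

lemma length_pencil_of [simp]: "length (pencil_of r n M) = 2 ^ n"
  by (simp add: pencil_of_def)

lemma pencil_of_nth: "i < 2 ^ n \<Longrightarrow> pencil_of r n M ! i = fiber r M (vec_of_nat i) - {0}"
  by (simp add: pencil_of_def)

lemma ordered_pencil_pencil_of:
  assumes "M \<in> indep_rows (f2_space r) \<rho>" "r = \<sigma> + \<rho>"
  shows "ordered_pencil r \<sigma> (pencil_of r \<rho> M)"
proof -
  have tl: "tl (pencil_of r \<rho> M) = map (\<lambda>i. fiber r M (vec_of_nat i)) [1..<2 ^ \<rho>]"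
    by (simp add: pencil_of_def map_tl[symmetric])
  have inj: "inj_on (\<lambda>i. fiber r M (vec_of_nat i)) {1..<2 ^ \<rho>}"
    by (rule inj_onI) (metis atLeastLessThan_iff inj_on_fiber[OF assms(1)] inj_onD
        vec_of_nat_eq_iff vec_of_nat_in_f2_space)
  have "vec_of_nat ` {1..<2 ^ \<rho>} = f2_space \<rho> - {0}"
  proof (intro equalityI subsetI)
    fix y assume "y \<in> f2_space \<rho> - {0}"
    then show "y \<in> vec_of_nat ` {1..<2 ^ \<rho>}"
      using f2_space_eq_vec_of_nat[of y \<rho>] by (force simp: Suc_le_eq)
  qed (auto simp: vec_of_nat_in_f2_space)
  then have "set (tl (pencil_of r \<rho> M)) = fiber r M ` (f2_space \<rho> - {0})"
    unfolding tl by (simp flip: image_image)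
  also have "\<dots> = f2_cosets r (fiber r M 0) - {fiber r M 0}"
    using inj_on_fiber[OF assms(1)] by (auto simp: cosets_fiber_0[OF assms(1)] inj_on_def)
  finally have "set (tl (pencil_of r \<rho> M)) = f2_cosets r (fiber r M 0) - {fiber r M 0}" .
  moreover have "distinct (tl (pencil_of r \<rho> M))"
    using inj by (simp add: tl distinct_map)
  moreover have "F2.dim (fiber r M 0) = \<sigma>"
    using card_fiber[OF assms(1), of 0] assms(2) by (simp add: f2_dim_eq_iff subspace_fiber_0)
  ultimately show ?thesis
    using assms(2) fiber_subset subspace_fiber_0
    by (simp add: ordered_pencil_def Let_def pencil_of_nth[of 0] insert_absorb)
qed

text \<open>The index of the entry containing a nonzero \<open>x\<close> reveals the image of
  \<open>x\<close>, and the images of the unit vectors are the columns of the matrix.\<close>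

lemma inj_on_pencil_of: "inj_on (pencil_of r n) (indep_rows (f2_space r) n)"
proof (rule inj_onI)
  fix M N assume M: "M \<in> indep_rows (f2_space r) n" and N: "N \<in> indep_rows (f2_space r) n"
    and eq: "pencil_of r n M = pencil_of r n N"
  have app: "app r M x = app r N x" if x: "x \<in> f2_space r" for x
  proof (cases "x = 0")
    case False
    obtain i where i: "i < 2 ^ n" "app r M x = vec_of_nat i"
      using f2_space_eq_vec_of_nat[OF app_in_f2_space[OF M]] by blast
    then have "x \<in> pencil_of r n M ! i" using False x by (simp add: pencil_of_nth fiber_def)
    then show ?thesis using i by (simp add: eq pencil_of_nth fiber_def)
  qed simp
  have "M k i = N k i" for k i
  proof (cases "k < n \<and> i < r")
    case True
    then show ?thesis
      using fun_cong[OF app[OF unit_vec_in_f2_space], of i k] by (simp add: app_def dot_unit_vec)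
  next
    case False
    then show ?thesis
      using M N by (cases "k < n") (simp_all add: indep_rows_def f2_space_def)
  qed
  then show "M = N" by (simp add: fun_eq_iff)
qed

section \<open>Shears give neighbours\<close>

lemma app_shear: "app r (shear M a c) x = app r M x + f2_scale (dot r c x) a"
  by (simp add: app_def shear_def fun_eq_iff) (simp add: f2_scale_def mult.commute)

lemma comb_shear: "comb n (shear M a c) b = comb n M b + f2_scale (dot n b a) c"
  by (simp add: comb_def shear_def f2_scale_def dot_def fun_eq_iff algebra_simps sum.distrib
      sum_distrib_left sum_distrib_right)

text \<open>A vanishing combination of the new rows is either a vanishing combination of the old
  ones or expresses \<open>c\<close> by them.\<close>

lemma shear_in_indep_rows:
  assumes X: "F2.subspace X" and M: "M \<in> indep_rows X n"
    and c: "c \<in> X" "c \<notin> row_space n M" and a: "a \<in> f2_space n"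
  shows "shear M a c \<in> indep_rows X n"
proof -
  have "b = 0" if b: "b \<in> f2_space n" "comb n (shear M a c) b = 0" for b
  proof (cases "dot n b a")
    case zero
    then show ?thesis using b M by (auto simp: comb_shear indep_rows_def)
  next
    case one
    then have "c = comb n M b" using b(2) by (simp add: comb_shear)
    then show ?thesis using c(2) by (auto simp: row_space_def)
  qed
  then show ?thesis
    using X M c a by (auto simp: indep_rows_def shear_def f2_space_def F2.subspace_add F2.subspace_scale)
qed

lemma indep_rows_extend:
  assumes "M \<in> indep_rows X n" "c \<in> X" "c \<notin> row_space n M"
  shows "M(n := c) \<in> indep_rows X (Suc n)"
  using assms by (auto simp: indep_rows_Suc intro!: rev_image_eqI[of "(M, c)"])

lemma card_hyperplane:
  assumes "c \<in> f2_space r" "c \<noteq> 0"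
  shows "card {x \<in> f2_space r. dot r c x = 0} = 2 ^ (r - 1)"
proof -
  have "0 \<in> indep_rows (f2_space r) 0"
    by (auto simp: indep_rows_def f2_space_def fun_eq_iff)
  then have "(0 :: nat \<Rightarrow> f2vec)(0 := c) \<in> indep_rows (f2_space r) (Suc 0)"
    using assms by (intro indep_rows_extend) simp_all
  from card_fiber[OF this, of 0] have "card (fiber r ((0 :: nat \<Rightarrow> f2vec)(0 := c)) 0) = 2 ^ (r - 1)"
    by simp
  moreover have "fiber r ((0 :: nat \<Rightarrow> f2vec)(0 := c)) 0 = {x \<in> f2_space r. dot r c x = 0}"
    by (auto simp: fiber_def app_def fun_eq_iff)
  ultimately show ?thesis by simp
qed

text \<open>For nonzero \<open>a\<close> the two maps agree exactly where \<open>c\<close> vanishes.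
  With \<open>c\<close> as row \<open>n\<close> this locus is a fibre over the same
  \<open>y\<close>, whose coordinate \<open>n\<close> is 0.\<close>

lemma fiber_Int_shear:
  assumes "M \<in> indep_rows X n" "y \<in> f2_space n" "a \<noteq> 0"
  shows "fiber r M y \<inter> fiber r (shear M a c) y = fiber r (M(n := c)) y"
proof -
  have 1: "app r M x n = 0" for x
    using app_in_f2_space[OF assms(1), of r x] by (simp add: f2_space_def)
  have 2: "y n = 0" using assms(2) by (simp add: f2_space_def)
  have 3: "app r (M(n := c)) x = (app r M x)(n := dot r c x)" for x
    by (auto simp: app_def)
  have "app r M x = y \<and> app r (shear M a c) x = y \<longleftrightarrow> app r (M(n := c)) x = y" for x
  proof -
    have "app r M x = y \<and> app r (shear M a c) x = y \<longleftrightarrow> app r M x = y \<and> dot r c x = 0"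
      using assms(3) by (cases "dot r c x") (auto simp: app_shear)
    also have "\<dots> \<longleftrightarrow> app r (M(n := c)) x = y"
      unfolding 3 using 1[of x] 2 by (metis fun_upd_same fun_upd_triv)
    finally show ?thesis .
  qed
  then show ?thesis by (auto simp: fiber_def)
qed

text \<open>The extended tuple \<open>N\<close> settles all three conditions: its kernel is
  \<open>T\<close>, of dimension \<open>r - (\<rho> + 1)\<close>; its fibres over the nonzero
  vectors of \<open>f2_space \<rho>\<close> are cosets of \<open>T\<close> other than
  \<open>T\<close>; and all its fibres over \<open>f2_space \<rho>\<close> together form the
  hyperplane where \<open>c\<close> vanishes.\<close>

lemma pencil_adj_shear:
  assumes M: "M \<in> indep_rows (f2_space r) \<rho>" and r: "r = \<sigma> + \<rho>"
    and a: "a \<in> f2_space \<rho>" "a \<noteq> 0" and c: "c \<in> f2_space r" "c \<notin> row_space \<rho> M"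
  shows "pencil_adj r \<sigma> (pencil_of r \<rho> M) (pencil_of r \<rho> (shear M a c))"
proof -
  define N where "N = M(\<rho> := c)"
  have N: "N \<in> indep_rows (f2_space r) (Suc \<rho>)"
    unfolding N_def by (rule indep_rows_extend[OF M c])
  have sub: "f2_space \<rho> \<subseteq> f2_space (Suc \<rho>)" by (rule f2_space_mono) simp
  let ?v = "pencil_of r \<rho> M" and ?w = "pencil_of r \<rho> (shear M a c)"
  have nth: "?v ! i \<inter> ?w ! i = fiber r N (vec_of_nat i) - {0}" if "i < 2 ^ \<rho>" for i
    using fiber_Int_shear[OF M vec_of_nat_in_f2_space[OF that] a(2)] that
    by (auto simp: pencil_of_nth N_def)
  define T where "T = ?v ! 0 \<inter> ?w ! 0 \<union> {0}"
  have T: "T = fiber r N 0" by (auto simp: T_def nth)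
  have dim_T: "F2.dim T = \<sigma> - 1"
    using card_fiber[OF N, of 0] r by (simp add: T f2_dim_eq_iff subspace_fiber_0)
  have cos: "?v ! i \<inter> ?w ! i \<in> f2_cosets r T \<and> ?v ! i \<inter> ?w ! i \<noteq> T"
    if i: "i \<in> {1..2 ^ (r - \<sigma>) - 1}" for i
  proof -
    have i': "i < 2 ^ \<rho>" "i \<noteq> 0" using i r by (auto simp: Suc_le_eq)
    have "vec_of_nat i \<in> f2_space (Suc \<rho>)" using vec_of_nat_in_f2_space[OF i'(1)] sub by blast
    then show ?thesis
      using i' inj_onD[OF inj_on_fiber[OF N], of "vec_of_nat i" 0]
      by (auto simp: nth T cosets_fiber_0[OF N])
  qed
  define U where "U = (\<Union>i\<in>{0..2 ^ (r - \<sigma>) - 1}. ?v ! i \<inter> ?w ! i) \<union> {0}"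
  have U: "U = {x \<in> f2_space r. dot r c x = 0}"
  proof -
    have "{0..2 ^ (r - \<sigma>) - 1} = {..<2 ^ \<rho> :: nat}" using r by (auto simp: Suc_le_eq le_diff_conv2)
    then have "U = (\<Union>i<2 ^ \<rho>. fiber r N (vec_of_nat i) - {0}) \<union> {0}"
      by (simp add: U_def nth)
    also have "\<dots> = (\<Union>y\<in>vec_of_nat ` {..<2 ^ \<rho>}. fiber r N y - {0}) \<union> {0}"
      by simp
    also have "vec_of_nat ` {..<2 ^ \<rho>} = f2_space \<rho>"
      using bij_betw_vec_of_nat by (simp add: bij_betw_def)
    also have "(\<Union>y\<in>f2_space \<rho>. fiber r N y - {0}) \<union> {0} = (\<Union>y\<in>f2_space \<rho>. fiber r N y)"
    proof -
      have "0 \<in> fiber r N 0" "(0 :: f2vec) \<in> f2_space \<rho>" by simp_all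
      then show ?thesis by blast
    qed
    also have "\<dots> = {x \<in> f2_space r. dot r c x = 0}"
    proof (intro equalityI subsetI)
      fix x assume "x \<in> (\<Union>y\<in>f2_space \<rho>. fiber r N y)"
      then have "x \<in> f2_space r" "app r N x \<rho> = 0" by (auto simp: fiber_def f2_space_def)
      then show "x \<in> {x \<in> f2_space r. dot r c x = 0}" by (simp add: app_def N_def)
    next
      fix x assume x: "x \<in> {x \<in> f2_space r. dot r c x = 0}"
      then have "app r N x = app r M x"
        using app_in_f2_space[OF M, of r x] by (auto simp: N_def app_def f2_space_def fun_eq_iff)
      then show "x \<in> (\<Union>y\<in>f2_space \<rho>. fiber r N y)"
        using x app_in_f2_space[OF M, of r x] by (auto simp: fiber_def)
    qed
    finally show ?thesis .
  qed
  have subU: "F2.subspace U" by (auto simp: U f2_subspace_iff)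
  have "c \<noteq> 0" using c(2) by auto
  then have "F2.dim U = r - 1"
    using card_hyperplane[OF c(1)] subU by (simp add: f2_dim_eq_iff U)
  then show ?thesis
    using dim_T cos subU subspace_fiber_0[of r N, folded T]
    unfolding pencil_adj_def Let_def T_def[symmetric] U_def[symmetric] by (intro conjI ballI) simp_all
qed

section \<open>Neighbours are shears\<close>

text \<open>Over this field additivity is linearity, and the coefficients are the values on the unit
  vectors.\<close>

lemma additive_eq_dot:
  assumes add: "\<And>x y. x \<in> f2_space r \<Longrightarrow> y \<in> f2_space r \<Longrightarrow> \<chi> (x + y) = \<chi> x + (\<chi> y :: bit)"
    and x: "x \<in> f2_space r"
  shows "\<chi> x = dot r (\<lambda>i. if i < r then \<chi> (unit_vec i) else 0) x"
proof -
  let ?c = "\<lambda>i. if i < r then \<chi> (unit_vec i) else 0"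
  \<comment> \<open>The induction runs over a bound \<open>n\<close> on the support, while the
    coefficients stay those for \<open>r\<close>.\<close>
  have "\<chi> x = dot r ?c x" if "x \<in> f2_space n" "n \<le> r" for n x
    using that
  proof (induction n arbitrary: x)
    case 0
    have "x = 0" using 0 by (auto simp: f2_space_def)
    moreover have "\<chi> 0 = 0" using add[of 0 0] by simp
    ultimately show ?case by (metis dot_0(2))
  next
    case (Suc n)
    show ?case
    proof (cases "x n")
      case zero
      then have "x \<in> f2_space n"
        using Suc.prems by (simp add: f2_space_def) (metis Suc_leI le_neq_implies_less)
      then show ?thesis using Suc by simp
    next
      case one
      let ?y = "unit_vec n + x"
      have u: "unit_vec n \<in> f2_space r" and n: "n < r"
        using Suc.prems by (simp_all add: unit_vec_in_f2_space)
      have y: "?y \<in> f2_space n"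
        unfolding f2_space_def
      proof clarify
        fix i assume "n \<le> i"
        then show "?y i = 0"
          using Suc.prems one by (cases "i = n") (auto simp: f2_space_def unit_vec_def)
      qed
      then have "?y \<in> f2_space r" using f2_space_mono[of n r] n by auto
      then have "\<chi> (unit_vec n + ?y) = \<chi> (unit_vec n) + \<chi> ?y"
        by (rule add[OF u])
      also have "\<chi> ?y = dot r ?c ?y"
        by (rule Suc.IH[OF y]) (use n in simp)
      also have "\<chi> (unit_vec n) = dot r ?c (unit_vec n)"
        using n by (simp only: dot_unit_vec) simp
      also have "\<dots> + dot r ?c ?y = dot r ?c (unit_vec n + ?y)"
        by (simp only: dot_add)
      finally show ?thesis by simp
    qed
  qed
  then show ?thesis using x by blast
qed

text \<open>By counting, \<open>U\<close> and its translate by an outside vector fill the space, so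
  two vectors outside \<open>U\<close> have their sum in \<open>U\<close>. Hence the indicator of
  the complement is additive.\<close>

lemma hyperplane_eq_kernel:
  assumes U: "F2.subspace U" "U \<subseteq> f2_space r" "card U = 2 ^ (r - 1)" and r: "r \<ge> 1"
  obtains c where "c \<in> f2_space r" "\<And>x. x \<in> f2_space r \<Longrightarrow> dot r c x = of_bool (x \<notin> U)"
proof -
  define \<chi> :: "f2vec \<Rightarrow> bit" where "\<chi> x = of_bool (x \<notin> U)" for x
  have sum_in: "x + y \<in> U" if "x \<in> f2_space r" "y \<in> f2_space r" "x \<notin> U" "y \<notin> U" for x y
  proof -
    have fin: "finite U" using U(2) finite_f2_space finite_subset by blast
    have disj: "U \<inter> (+) x ` U = {}"
    proof -
      have "x + u \<notin> U" if u: "u \<in> U" for u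
      proof
        assume "x + u \<in> U"
        then have "(x + u) + u \<in> U" using U(1) u by (metis f2_subspace_iff)
        then show False using \<open>x \<notin> U\<close> by (simp add: add.assoc)
      qed
      then show ?thesis by auto
    qed
    have "card (U \<union> (+) x ` U) = 2 * 2 ^ (r - 1)"
      using fin disj U(3) by (simp add: card_Un_disjoint card_image)
    also have "\<dots> = 2 ^ r" using r by (simp flip: power_Suc)
    finally have "card (U \<union> (+) x ` U) = 2 ^ r" .
    moreover have "U \<union> (+) x ` U \<subseteq> f2_space r" using U(2) that by auto
    ultimately have "U \<union> (+) x ` U = f2_space r"
      by (intro card_subset_eq) (simp_all add: card_f2_space)
    then have "y \<in> (+) x ` U" using that by auto
    then show ?thesis by auto
  qed
  have in_iff: "x + y \<in> U \<longleftrightarrow> y \<in> U" if "x \<in> U" for x y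
    using that U(1) unfolding f2_subspace_iff by (metis f2_add_left_self)
  have add: "\<chi> (x + y) = \<chi> x + \<chi> y" if "x \<in> f2_space r" "y \<in> f2_space r" for x y
    using sum_in[OF that] in_iff[of x y] in_iff[of y x]
    by (cases "x \<in> U"; cases "y \<in> U") (simp_all add: \<chi>_def add.commute)
  show ?thesis
  proof
    show "(\<lambda>i. if i < r then \<chi> (unit_vec i) else 0) \<in> f2_space r"
      by (simp add: f2_space_def)
    show "dot r (\<lambda>i. if i < r then \<chi> (unit_vec i) else 0) x = of_bool (x \<notin> U)"
      if "x \<in> f2_space r" for x
      using additive_eq_dot[of r \<chi>, OF add that] by (simp add: \<chi>_def)
  qed
qed

text \<open>Both cosets are the translate of \<open>S\<close> by their common element.\<close>

lemma cosets_eq_or_disjoint: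
  assumes "F2.subspace S" "A \<in> f2_cosets r S" "B \<in> f2_cosets r S" "z \<in> A" "z \<in> B"
  shows "A = B"
proof -
  have *: "y +o S = z +o S" if "z \<in> y +o S" for y
  proof -
    obtain s where s: "s \<in> S" "z = y + s" using \<open>z \<in> y +o S\<close> by (auto simp: elt_set_plus_def)
    have "x \<in> y +o S \<longleftrightarrow> x \<in> z +o S" for x
    proof
      assume "x \<in> y +o S"
      then obtain t where "t \<in> S" "x = y + t" by (auto simp: elt_set_plus_def)
      then show "x \<in> z +o S"
        using s assms(1) by (auto simp: elt_set_plus_def f2_subspace_iff add.assoc intro!: bexI[of _ "s + t"])
    next
      assume "x \<in> z +o S"
      then obtain t where "t \<in> S" "x = z + t" by (auto simp: elt_set_plus_def)
      then show "x \<in> y +o S"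
        using s assms(1) by (auto simp: elt_set_plus_def f2_subspace_iff add.assoc intro!: bexI[of _ "s + t"])
    qed
    then show ?thesis by blast
  qed
  show ?thesis using assms(2-) * by (auto simp: f2_cosets_def)
qed

lemma self_in_coset:
  assumes "F2.subspace S"
  shows "x \<in> x +o S"
proof -
  have "x + 0 \<in> x +o S"
    using assms by (intro set_plus_intro2) (simp add: f2_subspace_iff)
  then show ?thesis by simp
qed

lemma coset_add:
  assumes "F2.subspace S" "A \<in> f2_cosets r S" "x \<in> A" "s \<in> S"
  shows "x + s \<in> A"
proof -
  obtain a t where at: "A = a +o S" "t \<in> S" "x = a + t"
    using assms(2,3) by (auto simp: f2_cosets_def elt_set_plus_def)
  then have "x + s = a + (t + s)" by (simp add: add.assoc)
  moreover have "t + s \<in> S" using assms(1,4) at(2) by (simp add: f2_subspace_iff)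
  ultimately show ?thesis unfolding at(1) elt_set_plus_def by blast
qed

text \<open>A priori \<open>w\<close> is only a labelling of cosets, not known to come from a linear
  map. The hyperplane of agreement yields the candidate shear, whose fibres are then matched with
  the entries of \<open>w\<close>.\<close>

lemma adjacent_imp_shear:
  assumes M: "M \<in> indep_rows (f2_space r) \<rho>" and r: "r = \<sigma> + \<rho>" and \<sigma>: "\<sigma> \<ge> 1"
    and w: "ordered_pencil r \<sigma> w" and adj: "pencil_adj r \<sigma> (pencil_of r \<rho> M) w"
  obtains a c where "a \<in> f2_space \<rho>" "a \<noteq> 0" "c \<in> f2_space r" "c \<notin> row_space \<rho> M"
    "w = pencil_of r \<rho> (shear M a c)"
proof -
  let ?v = "pencil_of r \<rho> M"
  define S where "S = w ! 0 \<union> {0}"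
  \<comment> \<open>Entry 0 gets its zero vector back, so that the \<open>W i\<close> are whole
    cosets and partition the space.\<close>
  define W where "W i = (if i = 0 then S else w ! i)" for i
  have len: "length w = 2 ^ \<rho>" and w0: "0 \<notin> w ! 0" and S: "S \<subseteq> f2_space r" "F2.subspace S"
    and dim_S: "F2.dim S = \<sigma>" and dist: "distinct (tl w)"
    and tl: "set (tl w) = f2_cosets r S - {S}"
    using w r by (auto simp: ordered_pencil_def S_def Let_def)
  have card_S: "card S = 2 ^ \<sigma>"
    using dim_S S finite_subset[OF S(1)] by (simp add: f2_dim_eq_iff)
  have tl_nth: "tl w ! (i - 1) = W i" if "0 < i" "i < 2 ^ \<rho>" for i
    using that len by (simp add: W_def nth_tl)
  have S_coset: "S \<in> f2_cosets r S"
    by (auto simp: f2_cosets_def elt_set_plus_def intro!: exI[of _ 0])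
  have W_tl: "W i \<in> set (tl w)" if "0 < i" "i < 2 ^ \<rho>" for i
    using that len by (metis One_nat_def Suc_pred diff_less_mono length_tl less_one linorder_not_le nat_neq_iff not_less_eq nth_mem tl_nth)
  have W_coset: "W i \<in> f2_cosets r S" if "i < 2 ^ \<rho>" for i
    using W_tl[OF _ that] tl S_coset by (cases "i = 0") (auto simp: W_def)
  have W_inj: "i = j" if "i < 2 ^ \<rho>" "j < 2 ^ \<rho>" "x \<in> W i" "x \<in> W j" for i j x
  proof -
    have eq: "W i = W j"
      by (rule cosets_eq_or_disjoint[OF S(2) W_coset W_coset]) (use that in auto)
    have W0: "W 0 = S" by (simp add: W_def)
    show ?thesis
    proof (cases "i = 0 \<or> j = 0")
      case True
      then show ?thesis using eq W_tl[OF _ that(1)] W_tl[OF _ that(2)] tl W0 by auto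
    next
      case False
      then have "tl w ! (i - 1) = tl w ! (j - 1)" using eq that tl_nth by simp
      then have "i - 1 = j - 1"
        using nth_eq_iff_index_eq[OF dist, of "i - 1" "j - 1"] False that len by auto
      then show ?thesis using False by linarith
    qed
  qed
  have W_ex: "\<exists>i<2 ^ \<rho>. x \<in> W i" if x: "x \<in> f2_space r" for x
  proof -
    have "x +o S \<in> f2_cosets r S" using x by (auto simp: f2_cosets_def)
    moreover have "x \<in> x +o S" by (rule self_in_coset[OF S(2)])
    moreover have "\<exists>i<2 ^ \<rho>. C = W i" if "C \<in> f2_cosets r S" for C
    proof (cases "C = S")
      case True
      then show ?thesis by (intro exI[of _ 0]) (simp add: W_def)
    next
      case False
      then have "C \<in> set (tl w)" using that tl by simp
      then obtain k where "k < length (tl w)" "C = tl w ! k" by (metis in_set_conv_nth)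
      then have "Suc k < 2 ^ \<rho>" "C = W (Suc k)" using len tl_nth[of "Suc k"] by simp_all
      then show ?thesis by blast
    qed
    ultimately show ?thesis by blast
  qed
  have W_sub: "W i \<subseteq> f2_space r" if "i < 2 ^ \<rho>" for i
    using W_coset[OF that] S(1) by (auto simp: f2_cosets_def elt_set_plus_def intro!: f2_space_add)
  have w_eq: "w ! i = W i - {0}" if "i < 2 ^ \<rho>" for i
  proof (cases "i = 0")
    case True
    then show ?thesis using w0 by (simp add: W_def S_def)
  next
    case False
    have "0 \<in> W 0" by (simp add: W_def S_def)
    then have "0 \<notin> W i" using W_inj[OF that] False by force
    then show ?thesis using False by (simp add: W_def)
  qed

  define U where "U = (\<Union>i\<in>{0..2 ^ (r - \<sigma>) - 1}. ?v ! i \<inter> w ! i) \<union> {0}"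
  define T where "T = ?v ! 0 \<inter> w ! 0 \<union> {0}"
  have U_iff: "x \<in> U \<longleftrightarrow> x = 0 \<or> (\<exists>i<2 ^ \<rho>. x \<in> ?v ! i \<and> x \<in> w ! i)" for x
  proof -
    have "{0..2 ^ (r - \<sigma>) - 1} = {..<2 ^ \<rho> :: nat}" using r by (auto simp: Suc_le_eq le_diff_conv2)
    then show ?thesis by (auto simp: U_def)
  qed
  have U: "F2.subspace U" "F2.dim U = r - 1" and T: "F2.subspace T" "F2.dim T = \<sigma> - 1"
    using adj by (simp_all add: pencil_adj_def Let_def U_def T_def)
  have U_sub: "U \<subseteq> f2_space r"
    using fiber_subset by (fastforce simp: U_iff pencil_of_nth)
  have T_sub: "T \<subseteq> f2_space r"
    using fiber_subset by (fastforce simp: T_def pencil_of_nth)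
  have card_T: "card T = 2 ^ (\<sigma> - 1)"
    using T finite_subset[OF T_sub] by (simp add: f2_dim_eq_iff)
  have T_less: "card T < 2 ^ \<sigma>" unfolding card_T using \<sigma> by simp
  have card_U: "card U = 2 ^ (r - 1)"
    using U finite_subset[OF U_sub] by (simp add: f2_dim_eq_iff)
  obtain c where c: "c \<in> f2_space r" "\<And>x. x \<in> f2_space r \<Longrightarrow> dot r c x = of_bool (x \<notin> U)"
    using hyperplane_eq_kernel[OF U(1) U_sub card_U] r \<sigma> by auto
  have fin_T: "finite T" by (rule finite_subset[OF T_sub finite_f2_space])
  \<comment> \<open>Otherwise every nonzero vector of \<open>S\<close> lies in a common entry of the
    same index, which must be 0; then \<open>S\<close> is contained in \<open>T\<close>, which has
    half as many elements.\<close>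
  have "\<not> S \<subseteq> U"
  proof
    assume SU: "S \<subseteq> U"
    have "S \<subseteq> T"
    proof
      fix s assume s: "s \<in> S"
      then consider "s = 0" | i where "i < 2 ^ \<rho>" "s \<in> ?v ! i" "s \<in> w ! i" using SU U_iff by blast
      then show "s \<in> T"
      proof cases
        case 2
        then have "s \<in> W i" by (simp add: w_eq)
        moreover have "s \<in> W 0" using s by (simp add: W_def)
        ultimately have "i = 0" by (rule W_inj[OF 2(1), rotated]) simp
        then show ?thesis using 2 by (simp add: T_def)
      qed (simp add: T_def)
    qed
    then have "card S \<le> card T" by (rule card_mono[OF fin_T])
    then show False using card_S T_less by simp
  qed
  then obtain s where s: "s \<in> S" "s \<notin> U" by blast
  have sV: "s \<in> f2_space r" using s S by auto
  have s0: "s \<noteq> 0" using s U_iff by auto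
  \<comment> \<open>\<open>s\<close> lies in the kernel of \<open>w\<close> but off the hyperplane, which forces the shear vector.\<close>
  define a where "a = app r M s"
  have a: "a \<in> f2_space \<rho>" unfolding a_def by (rule app_in_f2_space[OF M])
  \<comment> \<open>If \<open>a\<close> were 0, then \<open>s\<close> would lie in entry 0 of both
    pencils and thus in \<open>U\<close>.\<close>
  have a0: "a \<noteq> 0"
  proof
    assume "a = 0"
    then have "s \<in> ?v ! 0" using s0 sV by (simp add: pencil_of_nth fiber_def a_def)
    moreover have "s \<in> w ! 0" using s s0 by (auto simp: S_def)
    ultimately show False using s(2) by (auto simp: U_iff intro!: exI[of _ 0])
  qed
  \<comment> \<open>A combination of rows vanishes on the kernel of \<open>M\<close>, which would
    then lie in \<open>U\<close> and therefore in \<open>T\<close>, too small to contain it.\<close>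
  have c_row: "c \<notin> row_space \<rho> M"
  proof
    assume "c \<in> row_space \<rho> M"
    then obtain b where b: "c = comb \<rho> M b" by (auto simp: row_space_def)
    have "fiber r M 0 \<subseteq> T"
    proof
      fix x assume x: "x \<in> fiber r M 0"
      then have "dot r (M k) x = 0" for k
        by (auto simp: fiber_def app_def fun_eq_iff)
      then have "dot r c x = 0" by (simp add: b dot_comb)
      moreover have "x \<in> f2_space r" using x by (simp add: fiber_def)
      ultimately have "x \<in> U" using c(2)[of x] by (auto simp: of_bool_def split: if_splits)
      then consider "x = 0" | i where "i < 2 ^ \<rho>" "x \<in> ?v ! i" "x \<in> w ! i" using U_iff by blast
      then show "x \<in> T"
      proof cases
        case 2
        then have "vec_of_nat i = 0" using x by (auto simp: pencil_of_nth fiber_def)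
        then have "i = 0" by simp
        then show ?thesis using 2 by (simp add: T_def)
      qed (simp add: T_def)
    qed
    then have "card (fiber r M 0) \<le> card T" by (rule card_mono[OF fin_T])
    moreover have "card (fiber r M 0) = 2 ^ \<sigma>" using card_fiber[OF M, of 0] r by simp
    ultimately show False using T_less by simp
  qed
  let ?N = "shear M a c"
  have in_U: "app r ?N x = vec_of_nat i" if "i < 2 ^ \<rho>" "x \<in> W i" "x \<in> U" for i x
  proof (cases "x = 0")
    case True
    then have "0 \<in> W i" using that by simp
    moreover have "0 \<in> W 0" by (simp add: W_def S_def)
    ultimately have "i = 0" by (rule W_inj[OF that(1), rotated]) simp
    then show ?thesis by (simp only: True app_0 vec_of_nat_0)
  next
    case False
    then obtain j where j: "j < 2 ^ \<rho>" "x \<in> ?v ! j" "x \<in> w ! j"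
      using iffD1[OF U_iff \<open>x \<in> U\<close>] by auto
    then have "x \<in> W j" by (simp add: w_eq)
    then have "j = i" by (rule W_inj[OF j(1) that(1) _ that(2)])
    moreover have "dot r c x = 0" using c(2)[OF subsetD[OF U_sub that(3)]] that(3) by simp
    ultimately show ?thesis using j by (simp add: pencil_of_nth fiber_def app_shear)
  qed
  \<comment> \<open>Since \<open>c\<close> is 1 at \<open>s\<close>, the added term is
    \<open>a\<close>, which cancels the image of \<open>s\<close> under \<open>M\<close>.\<close>
  have app_s: "app r ?N s = 0"
    using c(2)[OF sV] s by (simp add: app_shear a_def)
  have app_W: "app r ?N x = vec_of_nat i" if "i < 2 ^ \<rho>" "x \<in> W i" for i x
  proof (cases "x \<in> U")
    case True
    then show ?thesis by (rule in_U[OF that])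
  next
    case False
    have x: "x \<in> f2_space r" by (rule subsetD[OF W_sub that(2)]) (rule that(1))
    \<comment> \<open>Translation by \<open>s\<close> keeps \<open>x\<close> in \<open>W i\<close>
      but flips the value of \<open>c\<close>, so it leads into \<open>U\<close>, where the claim is
      already known.\<close>
    have "dot r c (x + s) = 0" using c(2)[OF x] c(2)[OF sV] False s by simp
    then have "x + s \<in> U" using c(2)[OF f2_space_add[OF x sV]] by (auto simp: of_bool_def split: if_splits)
    moreover have "x + s \<in> W i" by (rule coset_add[OF S(2) W_coset[OF that(1)] that(2) s(1)])
    ultimately have "app r ?N (x + s) = vec_of_nat i" by (intro in_U[OF that(1)])
    then show ?thesis by (simp only: app_add app_s add_0_right)
  qed
  have "W i = fiber r ?N (vec_of_nat i)" if i: "i < 2 ^ \<rho>" for i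
  proof (intro equalityI subsetI)
    fix x assume "x \<in> W i"
    then show "x \<in> fiber r ?N (vec_of_nat i)" using app_W W_sub i by (auto simp: fiber_def)
  next
    fix x assume x: "x \<in> fiber r ?N (vec_of_nat i)"
    then obtain j where j: "j < 2 ^ \<rho>" "x \<in> W j" using W_ex by (auto simp: fiber_def)
    then have "vec_of_nat j = vec_of_nat i" using app_W x by (auto simp: fiber_def)
    then show "x \<in> W i" using j by simp
  qed
  then have "w = pencil_of r \<rho> ?N"
    by (intro nth_equalityI) (simp_all add: len w_eq pencil_of_nth)
  then show ?thesis by (rule that[OF a a0 c(1) c_row])
qed

section \<open>Row replacement\<close>

text \<open>A relation on tuples, so that walk lengths are exponents of its relational
  powers.\<close>

definition shear_step :: "nat \<Rightarrow> nat \<Rightarrow> (nat \<Rightarrow> f2vec) rel" where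
  "shear_step r n = {(M, shear M a c) | M a c.
     M \<in> indep_rows (f2_space r) n \<and> a \<in> f2_space n - {0} \<and> c \<in> f2_space r - row_space n M}"

lemma shear_stepI:
  "M \<in> indep_rows (f2_space r) n \<Longrightarrow> a \<in> f2_space n - {0} \<Longrightarrow> c \<in> f2_space r - row_space n M \<Longrightarrow>
    (M, shear M a c) \<in> shear_step r n"
  unfolding shear_step_def by blast

lemma shear_step_in_indep_rows:
  "(M, N) \<in> shear_step r n \<Longrightarrow> M \<in> indep_rows (f2_space r) n \<and> N \<in> indep_rows (f2_space r) n"
  by (auto simp: shear_step_def intro!: shear_in_indep_rows subspace_f2_space)

text \<open>The replacement is the shear along \<open>unit_vec j\<close> with
  \<open>c = M j + h\<close>; as \<open>M j\<close> is in the row space, \<open>c\<close> is outside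
  it whenever \<open>h\<close> is.\<close>

lemma replace_row_step:
  assumes M: "M \<in> indep_rows (f2_space r) n" and j: "j < n"
    and h: "h \<in> f2_space r" "h \<notin> row_space n M"
  shows "(M, M(j := h)) \<in> shear_step r n"
proof -
  have "shear M (unit_vec j) (M j + h) = M(j := h)"
    by (rule ext) (simp add: shear_def unit_vec_def)
  moreover have "unit_vec j \<in> f2_space n - {0}" using j by (simp add: unit_vec_in_f2_space)
  moreover have "M j + h \<in> f2_space r"
    using M j h(1) by (intro f2_space_add) (simp_all add: indep_rows_def)
  moreover have "M j + h \<notin> row_space n M"
  proof
    assume "M j + h \<in> row_space n M"
    then have "M j + (M j + h) \<in> row_space n M"
      using row_in_row_space[OF j] row_space_add by blast
    then show False using h(2) by simp
  qed
  ultimately show ?thesis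
    using shear_stepI[OF M, of "unit_vec j" "M j + h"] by simp
qed

lemma comb_cong_support:
  assumes "\<And>k. k < n \<Longrightarrow> b k = d k \<and> (d k = 0 \<or> M k = N k)"
  shows "comb n M b = comb n N d"
proof -
  have "b k * M k i = d k * N k i" if "k < n" for k i
    using assms[OF that] by auto
  then show ?thesis by (simp add: comb_def)
qed

lemma comb_fun_upd:
  assumes "j < n"
  shows "comb n (M(j := h)) d = comb n M (d(j := 0)) + f2_scale (d j) h"
proof
  fix i
  have "comb n (M(j := h)) d i = (\<Sum>k<n. (d(j := 0)) k * M k i + (if k = j then d j * h i else 0))"
    unfolding comb_def by (rule sum.cong) auto
  also have "\<dots> = (\<Sum>k<n. (d(j := 0)) k * M k i) + d j * h i"
    using assms by (simp add: sum.distrib)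
  finally show "comb n (M(j := h)) d i = (comb n M (d(j := 0)) + f2_scale (d j) h) i"
    by (simp add: comb_def f2_scale_def)
qed

lemma comb_coefficients_unique:
  assumes M: "M \<in> indep_rows X n" and eq: "comb n M b = comb n M d" and j: "j < n"
  shows "b j = d j"
proof -
  define e where "e = (\<lambda>k. if k < n then b k + d k else 0)"
  have "comb n M e = comb n M (b + d)" by (rule comb_cong) (simp add: e_def)
  then have "comb n M e = 0" using eq by (simp add: comb_add)
  moreover have "e \<in> f2_space n" by (simp add: e_def f2_space_def)
  ultimately have "e = 0" using M by (auto simp: indep_rows_def)
  then have "e j = 0" by simp
  then show ?thesis using j by (simp add: e_def)
qed

text \<open>Rows below \<open>k\<close> already agree with \<open>N\<close>, so the row sacrificed
  to make room for \<open>N k\<close> must have index at least \<open>k\<close>. Independence of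
  \<open>N\<close> guarantees such a row in the expansion of \<open>N k\<close>.\<close>

lemma shear_steps_prefix:
  assumes M: "M \<in> indep_rows (f2_space r) n" and N: "N \<in> indep_rows (f2_space r) n"
    and "n < r" "k \<le> n"
  shows "\<exists>M'\<in>indep_rows (f2_space r) n. \<exists>m\<le>2 * k. (M, M') \<in> shear_step r n ^^ m \<and> (\<forall>j<k. M' j = N j)"
  using \<open>k \<le> n\<close>
proof (induction k)
  case 0
  then show ?case using M by (auto intro!: bexI[of _ M] exI[of _ 0])
next
  case (Suc k)
  then obtain M' m where M': "M' \<in> indep_rows (f2_space r) n" and m: "m \<le> 2 * k"
    and path: "(M, M') \<in> shear_step r n ^^ m" and eq: "\<forall>j<k. M' j = N j"
    by auto
  have k: "k < n" using Suc.prems by simp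
  have Nk: "N k \<in> f2_space r" using N k by (simp add: indep_rows_def)
  \<comment> \<open>The final replacement, available once \<open>N k\<close> is outside the row
    space of \<open>L\<close>; reaching \<open>L\<close> may have used one extra step, hence the
    bound \<open>2 * k + 1\<close>.\<close>
  have finish: "\<exists>M'\<in>indep_rows (f2_space r) n. \<exists>m\<le>2 * Suc k. (M, M') \<in> shear_step r n ^^ m \<and> (\<forall>j<Suc k. M' j = N j)"
    if L: "L \<in> indep_rows (f2_space r) n" "N k \<notin> row_space n L" "\<forall>j<k. L j = N j"
      and l: "l \<le> 2 * k + 1" "(M, L) \<in> shear_step r n ^^ l" for L l
  proof -
    have step: "(L, L(k := N k)) \<in> shear_step r n"
      by (rule replace_row_step[OF L(1) k Nk L(2)])
    have "(M, L(k := N k)) \<in> shear_step r n ^^ Suc l"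
      using l(2) step by (rule relpow_Suc_I)
    moreover have "L(k := N k) \<in> indep_rows (f2_space r) n"
      using shear_step_in_indep_rows[OF step] by simp
    moreover have "\<forall>j<Suc k. (L(k := N k)) j = N j" using L(3) by (auto simp: less_Suc_eq)
    moreover have "Suc l \<le> 2 * Suc k" using l(1) by simp
    ultimately show ?thesis by blast
  qed
  show ?case
  proof (cases "N k \<in> row_space n M'")
    case False
    show ?thesis by (rule finish[OF M' False eq _ path]) (use m in simp)
  next
    case True
    then obtain b where b: "N k = comb n M' b" by (auto simp: row_space_def)
    have "\<exists>j<n. k \<le> j \<and> b j = 1"
    proof (rule ccontr)
      assume "\<not> ?thesis"
      then have b0: "b j = 0" if "k \<le> j" "j < n" for j
        using that by auto
      \<comment> \<open>A relation among the rows of \<open>N\<close>: adding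
        \<open>unit_vec k\<close> removes the 1 at \<open>k\<close> and leaves the expansion of
        \<open>N k\<close> by earlier rows.\<close>
      define d where "d = (\<lambda>j. if j < k then b j else if j = k then 1 else 0)"
      have "comb n N (d + unit_vec k) = comb n M' b"
        by (rule comb_cong_support) (use eq b0 in \<open>auto simp: d_def unit_vec_def\<close>)
      then have "comb n N d = 0"
        using k by (simp add: comb_add comb_unit_vec b[symmetric])
      moreover have "d \<in> f2_space n" using k by (auto simp: d_def f2_space_def)
      ultimately have "d = 0" using N by (auto simp: indep_rows_def)
      then have "d k = 0" by simp
      then show False by (simp add: d_def)
    qed
    then obtain j where j: "j < n" "k \<le> j" "b j = 1" by blast
    \<comment> \<open>Here \<open>n < r\<close> is decisive: a row space of size
      \<open>2 ^ n\<close> leaves vectors outside.\<close>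
    have "card (row_space n M') < card (f2_space r)"
      using \<open>n < r\<close> by (simp add: card_row_space[OF M'] card_f2_space)
    moreover have "finite (row_space n M')"
      using card_row_space[OF M'] by (metis card.infinite power_not_zero zero_neq_numeral)
    ultimately have "\<not> f2_space r \<subseteq> row_space n M'" using card_mono by (metis linorder_not_le)
    then obtain h where h: "h \<in> f2_space r" "h \<notin> row_space n M'" by blast
    have step: "(M', M'(j := h)) \<in> shear_step r n"
      by (rule replace_row_step[OF M' j(1) h])
    \<comment> \<open>An expansion of \<open>N k\<close> that uses \<open>h\<close> would put
      \<open>h\<close> into the old row space; one that avoids \<open>h\<close> would be a second
      expansion by the old rows, with coefficient 0 at \<open>j\<close> instead of 1.\<close>
    have notin: "N k \<notin> row_space n (M'(j := h))"
    proof
      assume "N k \<in> row_space n (M'(j := h))"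
      then obtain d where d: "N k = comb n (M'(j := h)) d" by (auto simp: row_space_def)
      have split: "comb n (M'(j := h)) d = comb n M' (d(j := 0)) + f2_scale (d j) h"
        by (rule comb_fun_upd[OF j(1)])
      show False
      proof (cases "d j")
        case zero
        then have "comb n M' b = comb n M' (d(j := 0))" using split b d by simp
        then have "b j = (d(j := 0)) j" by (rule comb_coefficients_unique[OF M' _ j(1)])
        then show False using j(3) by simp
      next
        case one
        then have "comb n M' (d(j := 0)) + h = comb n M' b"
          using split b d by simp
        then have "h = comb n M' (d(j := 0)) + comb n M' b"
          by (rule iffD1[OF f2_add_eq_iff])
        then have "h \<in> row_space n M'" by (simp add: row_space_def flip: comb_add)
        then show False using h(2) by simp
      qed
    qed
    show ?thesis
    proof (rule finish)
      show "M'(j := h) \<in> indep_rows (f2_space r) n"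
        using shear_step_in_indep_rows[OF step] by simp
      show "N k \<notin> row_space n (M'(j := h))" by (rule notin)
      show "\<forall>i<k. (M'(j := h)) i = N i" using eq j(2) by simp
      show "(M, M'(j := h)) \<in> shear_step r n ^^ Suc m" using path step by (rule relpow_Suc_I)
      show "Suc m \<le> 2 * k + 1" using m by simp
    qed
  qed
qed

lemma shear_steps_connected:
  assumes "M \<in> indep_rows (f2_space r) n" "N \<in> indep_rows (f2_space r) n" "n < r"
  shows "\<exists>m\<le>2 * n. (M, N) \<in> shear_step r n ^^ m"
proof -
  obtain M' m where M': "M' \<in> indep_rows (f2_space r) n" "m \<le> 2 * n" "(M, M') \<in> shear_step r n ^^ m"
    and eq: "\<forall>j<n. M' j = N j"
    using shear_steps_prefix[OF assms order_refl] by blast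
  have "M' j = N j" for j
    using eq M'(1) assms(2) by (cases "j < n") (simp_all add: indep_rows_def)
  then have "M' = N" by (rule ext)
  then show ?thesis using M' by blast
qed

section \<open>The component of the base pencil\<close>

text \<open>The projection onto the coordinates from \<open>d\<close> to \<open>d + n - 1\<close>.
  With \<open>d = \<sigma>\<close> it gives the base pencil; with \<open>d = 0\<close> it serves to
  count an annihilator.\<close>

definition unit_rows :: "nat \<Rightarrow> nat \<Rightarrow> nat \<Rightarrow> f2vec" where
  "unit_rows d n = (\<lambda>k. if k < n then unit_vec (d + k) else 0)"

lemma unit_rows_indep: "unit_rows d n \<in> indep_rows (f2_space (d + n)) n"
proof -
  have "b = 0" if b: "b \<in> f2_space n" "comb n (unit_rows d n) b = 0" for b
  proof
    fix j
    show "b j = 0 j"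
    proof (cases "j < n")
      case True
      have "comb n (unit_rows d n) b (d + j) = (\<Sum>k<n. if k = j then b j else 0)"
        unfolding comb_def by (rule sum.cong) (auto simp: unit_rows_def unit_vec_def)
      also have "\<dots> = b j" using True by simp
      finally show ?thesis using b(2) by simp
    next
      case False
      then show ?thesis using b(1) by (simp add: f2_space_def)
    qed
  qed
  then show ?thesis
    by (simp add: indep_rows_def unit_rows_def unit_vec_in_f2_space)
qed

lemma app_unit_rows:
  assumes "x \<in> f2_space (d + n)"
  shows "app (d + n) (unit_rows d n) x k = x (d + k)"
  using assms by (simp add: app_def unit_rows_def dot_unit_vec f2_space_def)

text \<open>On binary representations, dropping the lowest \<open>d\<close> digits is division by
  \<open>2 ^ d\<close>, so a fibre consists of the numbers with a given quotient.\<close>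

lemma fiber_unit_rows:
  assumes "i < 2 ^ n"
  shows "fiber (d + n) (unit_rows d n) (vec_of_nat i) = vec_of_nat ` {i * 2 ^ d..(i + 1) * 2 ^ d - 1}"
proof -
  have app: "app (d + n) (unit_rows d n) (vec_of_nat m) = vec_of_nat (m div 2 ^ d)"
    if "m < 2 ^ (d + n)" for m
  proof
    fix k
    have "app (d + n) (unit_rows d n) (vec_of_nat m) k = vec_of_nat m (d + k)"
      by (rule app_unit_rows) (rule vec_of_nat_in_f2_space[OF that])
    then show "app (d + n) (unit_rows d n) (vec_of_nat m) k = vec_of_nat (m div 2 ^ d) k"
      by (simp add: vec_of_nat_def bit_drop_bit_eq flip: drop_bit_eq_div)
  qed
  have div: "m div 2 ^ d = i \<longleftrightarrow> m \<in> {i * 2 ^ d..(i + 1) * 2 ^ d - 1}" for m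
  proof -
    have "m div 2 ^ d = i \<longleftrightarrow> i * 2 ^ d \<le> m \<and> m < (i + 1) * 2 ^ d"
    proof
      assume "m div 2 ^ d = i"
      then show "i * 2 ^ d \<le> m \<and> m < (i + 1) * 2 ^ d"
        using div_times_less_eq_dividend[of m "2 ^ d"] dividend_less_div_times[of "2 ^ d" m]
        by (simp add: algebra_simps)
    next
      assume "i * 2 ^ d \<le> m \<and> m < (i + 1) * 2 ^ d"
      then show "m div 2 ^ d = i" by (intro div_nat_eqI) (simp_all add: algebra_simps)
    qed
    moreover have "m < K \<longleftrightarrow> m \<le> K - 1" if "0 < K" for K :: nat
      using that by linarith
    then have "m < (i + 1) * 2 ^ d \<longleftrightarrow> m \<le> (i + 1) * 2 ^ d - 1" by simp
    ultimately show ?thesis by (simp only: atLeastAtMost_iff)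
  qed
  show ?thesis
  proof (intro equalityI subsetI)
    fix x assume x: "x \<in> fiber (d + n) (unit_rows d n) (vec_of_nat i)"
    then obtain m where m: "m < 2 ^ (d + n)" "x = vec_of_nat m"
      using f2_space_eq_vec_of_nat by (auto simp: fiber_def)
    then have "m div 2 ^ d = i" using x app[OF m(1)] by (simp add: fiber_def)
    then show "x \<in> vec_of_nat ` {i * 2 ^ d..(i + 1) * 2 ^ d - 1}" using m div by blast
  next
    fix x assume "x \<in> vec_of_nat ` {i * 2 ^ d..(i + 1) * 2 ^ d - 1}"
    then obtain m where m: "x = vec_of_nat m" "m div 2 ^ d = i" using div by blast
    have "m < 2 ^ n * 2 ^ d"
      by (rule iffD1[OF div_less_iff_less_mult]) (simp_all add: m(2) assms)
    then have "m < 2 ^ (d + n)" by (simp add: power_add mult.commute)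
    then show "x \<in> fiber (d + n) (unit_rows d n) (vec_of_nat i)"
      using app m by (simp add: fiber_def vec_of_nat_in_f2_space)
  qed
qed

lemma base_pencil_eq: "base_pencil (\<sigma> + \<rho>) \<sigma> = pencil_of (\<sigma> + \<rho>) \<rho> (unit_rows \<sigma> \<rho>)"
proof (rule nth_equalityI)
  show "length (base_pencil (\<sigma> + \<rho>) \<sigma>) = length (pencil_of (\<sigma> + \<rho>) \<rho> (unit_rows \<sigma> \<rho>))"
    by (simp add: base_pencil_def)
  fix i assume "i < length (base_pencil (\<sigma> + \<rho>) \<sigma>)"
  then have i: "i < 2 ^ \<rho>" by (simp add: base_pencil_def)
  show "base_pencil (\<sigma> + \<rho>) \<sigma> ! i = pencil_of (\<sigma> + \<rho>) \<rho> (unit_rows \<sigma> \<rho>) ! i"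
  proof (cases "i = 0")
    case True
    have "vec_of_nat ` {0..2 ^ \<sigma> - 1} - {0} = vec_of_nat ` {1..2 ^ \<sigma> - 1}"
      by (auto simp: Suc_le_eq intro!: image_eqI)
    then show ?thesis
      using fiber_unit_rows[OF i, of \<sigma>] True by (simp add: pencil_of_nth base_pencil_def)
  next
    case False
    then have "0 \<notin> vec_of_nat ` {i * 2 ^ \<sigma>..(i + 1) * 2 ^ \<sigma> - 1}" by auto
    then show ?thesis
      using fiber_unit_rows[OF i, of \<sigma>] i False
      by (simp add: pencil_of_nth base_pencil_def nth_Cons')
  qed
qed

text \<open>Taking \<open>2 ^ i\<close> out of each factor leaves the factors
  \<open>2 ^ (n - i + d) - 1\<close>, which are then rearranged in the opposite order; the powers of
  2 keep theirs.\<close>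

lemma prod_pow2_diff:
  "(\<Prod>i<n. 2 ^ (d + n) - 2 ^ i) = (\<Prod>i=1..n. 2 ^ (i - 1) * (2 ^ (i + d) - 1 :: nat))"
proof -
  have "(\<Prod>i<n. 2 ^ (d + n) - 2 ^ i) = (\<Prod>i<n. 2 ^ i * (2 ^ (n - i + d) - 1 :: nat))"
  proof (rule prod.cong)
    fix i assume "i \<in> {..<n}"
    then have "d + n = i + (n - i + d)" by simp
    then have "2 ^ (d + n) = 2 ^ i * (2 ^ (n - i + d) :: nat)" by (metis power_add)
    then show "2 ^ (d + n) - 2 ^ i = 2 ^ i * (2 ^ (n - i + d) - 1 :: nat)"
      by (simp add: diff_mult_distrib2)
  qed simp
  also have "\<dots> = (\<Prod>i<n. 2 ^ i) * (\<Prod>i<n. 2 ^ (n - i + d) - 1)"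
    by (rule prod.distrib)
  also have "(\<Prod>i<n. 2 ^ (n - i + d) - 1 :: nat) = (\<Prod>i<n. 2 ^ (Suc i + d) - 1)"
    by (rule prod.reindex_bij_witness[of _ "\<lambda>i. n - Suc i" "\<lambda>i. n - Suc i"]) (auto simp: Suc_diff_Suc)
  also have "(\<Prod>i<n. 2 ^ i) * (\<Prod>i<n. 2 ^ (Suc i + d) - 1) = (\<Prod>i<n. 2 ^ i * (2 ^ (Suc i + d) - 1 :: nat))"
    by (rule prod.distrib[symmetric])
  also have "\<dots> = (\<Prod>i=1..n. 2 ^ (i - 1) * (2 ^ (i + d) - 1 :: nat))"
    by (rule prod.reindex_bij_witness[of _ "\<lambda>i. i - 1" Suc]) auto
  finally show ?thesis .
qed

lemma card_indep_rows_eq: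
  assumes "F2.subspace X" "finite X" "card X = 2 ^ (d + n)"
  shows "card (indep_rows X n) = (\<Prod>i=1..n. 2 ^ (i - 1) * (2 ^ (i + d) - 1))"
  using card_indep_rows[OF assms(1,2), of n] by (simp add: assms(3) prod_pow2_diff)

text \<open>With \<open>\<rho>\<close> as a parameter of its own, \<open>r\<close> is a sum and no
  truncated difference appears.\<close>

locale pencil_parameters =
  fixes r \<sigma> \<rho> :: nat
  assumes r: "r = \<sigma> + \<rho>" and \<sigma>: "1 \<le> \<sigma>" and \<rho>: "1 \<le> \<rho>"
begin

abbreviation (input) rows where "rows \<equiv> indep_rows (f2_space r) \<rho>"
abbreviation (input) pen where "pen \<equiv> pencil_of r \<rho>"
abbreviation (input) G where "G \<equiv> pencil_graph r \<sigma>"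
abbreviation (input) C where "C \<equiv> component_graph r \<sigma>"
abbreviation (input) base where "base \<equiv> unit_rows \<sigma> \<rho>"

lemma base_in_rows: "base \<in> rows"
  unfolding r by (rule unit_rows_indep)

lemma base_pencil_eq_pen: "base_pencil r \<sigma> = pen base"
  unfolding r by (rule base_pencil_eq)

lemma pencil_graph_simps:
  "verts G = {v. ordered_pencil r \<sigma> v}"
  "arcs G = {(v, w). ordered_pencil r \<sigma> v \<and> ordered_pencil r \<sigma> w \<and> pencil_adj r \<sigma> v w}"
  "arcs_ends G = arcs G" "tail G = fst" "head G = snd"
  by (simp_all add: pencil_graph_def)

lemma arc_iff_shear_step:
  assumes "M \<in> rows"
  shows "(pen M, w) \<in> arcs G \<longleftrightarrow> (\<exists>N. (M, N) \<in> shear_step r \<rho> \<and> w = pen N)"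
proof
  assume "(pen M, w) \<in> arcs G"
  then have w: "ordered_pencil r \<sigma> w" "pencil_adj r \<sigma> (pen M) w"
    by (simp_all add: pencil_graph_simps)
  obtain a c where "a \<in> f2_space \<rho>" "a \<noteq> 0" "c \<in> f2_space r" "c \<notin> row_space \<rho> M"
    "w = pen (shear M a c)"
    by (rule adjacent_imp_shear[OF assms r \<sigma> w])
  then show "\<exists>N. (M, N) \<in> shear_step r \<rho> \<and> w = pen N"
    using assms by (auto simp: shear_step_def)
next
  assume "\<exists>N. (M, N) \<in> shear_step r \<rho> \<and> w = pen N"
  then obtain N where N: "(M, N) \<in> shear_step r \<rho>" "w = pen N" by blast
  have "pencil_adj r \<sigma> (pen M) (pen N)"
    using N(1) by (auto simp: shear_step_def intro!: pencil_adj_shear r)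
  then show "(pen M, w) \<in> arcs G"
    using shear_step_in_indep_rows[OF N(1)] ordered_pencil_pencil_of[OF _ r]
    by (simp add: pencil_graph_simps N(2))
qed

lemma shear_steps_reachable:
  assumes "(M, N) \<in> shear_step r \<rho> ^^ m" "M \<in> rows"
  shows "pen M \<rightarrow>\<^sup>*\<^bsub>G\<^esub> pen N \<and> N \<in> rows"
proof -
  interpret wf_digraph G by (rule sym_digraph_pencil_graph)
  show ?thesis
    using assms
  proof (induction m arbitrary: N)
    case 0
    then show ?case
      using ordered_pencil_pencil_of[OF assms(2) r] by (simp add: pencil_graph_simps(1))
  next
    case (Suc m)
    then obtain L where L: "(M, L) \<in> shear_step r \<rho> ^^ m" "(L, N) \<in> shear_step r \<rho>"
      by (auto elim: relpow_Suc_E)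
    have "pen M \<rightarrow>\<^sup>*\<^bsub>G\<^esub> pen L" "L \<in> rows" using Suc.IH[OF L(1) Suc.prems(2)] by auto
    moreover have "(pen L, pen N) \<in> arcs_ends G"
      unfolding pencil_graph_simps(3) arc_iff_shear_step[OF \<open>L \<in> rows\<close>] using L(2) by blast
    ultimately show ?case
      using shear_step_in_indep_rows[OF L(2)] reachable_adj_trans by blast
  qed
qed

text \<open>Arcs lead from tuples to tuples, which bounds the component from above. Conversely,
  shear steps join any two tuples in both directions, as a strongly connected component
  requires.\<close>

lemma verts_component: "verts C = pen ` rows"
proof -
  interpret wf_digraph G by (rule sym_digraph_pencil_graph)
  have "w \<in> pen ` rows" if "pen base \<rightarrow>\<^sup>*\<^bsub>G\<^esub> w" for w
    using that
  proof (induction rule: reachable_induct)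
    case base
    then show ?case using base_in_rows by blast
  next
    case (step v w)
    then obtain M where M: "M \<in> rows" "v = pen M" by blast
    then have "(pen M, w) \<in> arcs G" using step(2) by (simp add: pencil_graph_simps(3))
    then obtain N where "(M, N) \<in> shear_step r \<rho>" "w = pen N"
      using arc_iff_shear_step[OF M(1)] by blast
    then show ?case using shear_step_in_indep_rows by blast
  qed
  moreover have "pen base \<rightarrow>\<^sup>*\<^bsub>G\<^esub> pen M \<and> pen M \<rightarrow>\<^sup>*\<^bsub>G\<^esub> pen base" if M: "M \<in> rows" for M
  proof -
    have "\<rho> < r" using r \<sigma> by simp
    then have "\<exists>m. (base, M) \<in> shear_step r \<rho> ^^ m" "\<exists>m. (M, base) \<in> shear_step r \<rho> ^^ m"
      using shear_steps_connected[OF base_in_rows M] shear_steps_connected[OF M base_in_rows] by blast+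
    then show ?thesis using shear_steps_reachable M base_in_rows by blast
  qed
  ultimately show ?thesis
    unfolding component_graph_def induce_subgraph_verts scc_of_def base_pencil_eq_pen by blast
qed

lemma component_graph_simps:
  "arcs C = {e \<in> arcs G. fst e \<in> verts C \<and> snd e \<in> verts C}" "tail C = fst" "head C = snd"
  by (auto simp: component_graph_def pencil_graph_simps induce_subgraph_def)

lemma wf_component: "wf_digraph C"
  by (simp add: wf_digraph_def component_graph_simps)

lemma arc_component_iff:
  assumes "M \<in> rows"
  shows "(pen M, w) \<in> arcs C \<longleftrightarrow> (\<exists>N. (M, N) \<in> shear_step r \<rho> \<and> w = pen N)"
  using arc_iff_shear_step[OF assms] shear_step_in_indep_rows assms
  unfolding component_graph_simps verts_component by fastforce

lemma card_component: "card (verts C) = (\<Prod>i=1..\<rho>. 2 ^ (i - 1) * (2 ^ (i + \<sigma>) - 1))"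
proof -
  have "card (verts C) = card rows"
    unfolding verts_component by (rule card_image[OF inj_on_pencil_of])
  then show ?thesis
    using card_indep_rows_eq[OF subspace_f2_space finite_f2_space, of r \<sigma> \<rho>]
    by (simp add: card_f2_space r)
qed

text \<open>Arcs out of a vertex correspond to pairs \<open>(a, c)\<close>: the only nonzero scalar
  is 1, so a nonzero rank-one term \<open>a c\<close> determines both factors. This leaves
  \<open>(2 ^ \<rho> - 1) * (2 ^ r - 2 ^ \<rho>)\<close> pairs.\<close>

lemma regular_component: "regular_of_degree C (2 ^ (\<rho> - 1) * (2 ^ \<rho> - 1) * (2 ^ (\<sigma> + 1) - 1 - 1))"
  unfolding regular_of_degree_def
proof
  fix v assume "v \<in> verts C"
  then obtain M where M: "M \<in> rows" and v: "v = pen M" by (auto simp: verts_component)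
  let ?A = "(f2_space \<rho> - {0}) \<times> (f2_space r - row_space \<rho> M)"
  let ?f = "\<lambda>(a, c). (pen M, pen (shear M a c))"
  have step: "(M, shear M a c) \<in> shear_step r \<rho>" if "(a, c) \<in> ?A" for a c
    using that M by (auto simp: shear_step_def)
  have "out_arcs C v = ?f ` ?A"
  proof (intro equalityI subsetI)
    fix e assume e: "e \<in> out_arcs C v"
    then obtain w where w: "e = (pen M, w)" "(pen M, w) \<in> arcs C"
      by (cases e) (auto simp: component_graph_simps v)
    then obtain N where "(M, N) \<in> shear_step r \<rho>" "w = pen N"
      using arc_component_iff[OF M] by blast
    then show "e \<in> ?f ` ?A" using w(1) by (force simp: shear_step_def)
  next
    fix e assume "e \<in> ?f ` ?A"
    then obtain a c where ac: "(a, c) \<in> ?A" "e = (pen M, pen (shear M a c))" by auto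
    then have "e \<in> arcs C" using arc_component_iff[OF M] step by blast
    then show "e \<in> out_arcs C v" using ac(2) by (simp add: component_graph_simps(2) v)
  qed
  moreover have "inj_on ?f ?A"
  proof (rule inj_onI)
    fix p q assume "p \<in> ?A" "q \<in> ?A" "?f p = ?f q"
    then obtain a c b d where p: "p = (a, c)" and q: "q = (b, d)"
      and ac: "(a, c) \<in> ?A" and bd: "(b, d) \<in> ?A"
      and eq: "pen (shear M a c) = pen (shear M b d)"
      by (cases p; cases q) auto
    have c0: "c \<noteq> 0" "d \<noteq> 0" and a0: "a \<noteq> 0" using ac bd by auto
    have "shear M a c = shear M b d"
      using inj_on_pencil_of[THEN inj_onD, OF eq] shear_step_in_indep_rows step[OF ac] step[OF bd] by blast
    then have sc: "f2_scale (a k) c = f2_scale (b k) d" for k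
      by (simp add: shear_def fun_eq_iff)
    \<comment> \<open>Row \<open>k\<close> of the difference is 0 or the nonzero vector
      \<open>c\<close>, so it shows the bit \<open>a k\<close>.\<close>
    have zero_iff: "a k = 0 \<longleftrightarrow> b k = 0" for k
      using sc[of k] c0 by (cases "a k"; cases "b k") auto
    have ab: "a = b"
    proof
      fix k show "a k = b k" using zero_iff[of k] by (cases "a k"; cases "b k") auto
    qed
    obtain k where "a k \<noteq> 0" using a0 by (auto simp: fun_eq_iff)
    then have "c = d" using sc[of k] ab by simp
    then show "p = q" by (simp add: p q ab)
  qed
  ultimately have "out_degree C v = card ?A"
    by (simp add: out_degree_def card_image)
  also have "\<dots> = (2 ^ \<rho> - 1) * (2 ^ r - 2 ^ \<rho>)"
  proof -
    have sub: "row_space \<rho> M \<subseteq> f2_space r"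
      using M by (intro row_space_subset subspace_f2_space) (simp add: indep_rows_def)
    then have "card (f2_space r - row_space \<rho> M) = 2 ^ r - 2 ^ \<rho>"
      using card_row_space[OF M] finite_subset[OF sub]
      by (simp add: card_Diff_subset card_f2_space)
    then show ?thesis by (simp add: card_cartesian_product card_f2_space)
  qed
  also have "(2 :: nat) ^ r - 2 ^ \<rho> = 2 ^ (\<rho> - 1) * (2 ^ (\<sigma> + 1) - 2)"
  proof -
    obtain q where "\<rho> = Suc q" using \<rho> by (cases \<rho>) auto
    then show ?thesis by (simp add: r power_add diff_mult_distrib2 mult.commute mult.left_commute)
  qed
  finally show "out_degree C v = 2 ^ (\<rho> - 1) * (2 ^ \<rho> - 1) * (2 ^ (\<sigma> + 1) - 1 - 1)"
    by (simp add: mult_ac numeral_2_eq_2)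
qed

lemma shear_steps_awalk:
  assumes "(M, N) \<in> shear_step r \<rho> ^^ m" "M \<in> rows" "N \<in> rows"
  shows "\<exists>p. pre_digraph.awalk C (pen M) p (pen N) \<and> length p = m"
proof -
  interpret wf_digraph C by (rule wf_component)
  show ?thesis
    using assms
  proof (induction m arbitrary: M)
    case 0
    then show ?case by (auto simp: awalk_Nil_iff verts_component)
  next
    case (Suc m)
    then obtain L where L: "(M, L) \<in> shear_step r \<rho>" "(L, N) \<in> shear_step r \<rho> ^^ m"
      by (meson relpow_Suc_D2)
    then obtain p where "awalk (pen L) p (pen N)" "length p = m"
      using Suc.IH Suc.prems(3) shear_step_in_indep_rows by blast
    moreover have "(pen M, pen L) \<in> arcs C" using arc_component_iff[OF Suc.prems(2)] L(1) by blast
    ultimately have "awalk (pen M) ((pen M, pen L) # p) (pen N) \<and> length ((pen M, pen L) # p) = Suc m"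
      by (simp add: awalk_Cons_iff component_graph_simps(2,3))
    then show ?case by blast
  qed
qed

lemma diameter_component_le: "graph_diameter C \<le> ereal (2 * real \<rho>)"
proof -
  interpret wf_digraph C by (rule wf_component)
  have "\<mu> (\<lambda>_. 1) u v \<le> ereal (2 * real \<rho>)" if uv: "u \<in> verts C" "v \<in> verts C" for u v
  proof -
    obtain M N where MN: "M \<in> rows" "N \<in> rows" "u = pen M" "v = pen N"
      using uv by (auto simp: verts_component)
    have "\<rho> < r" using r \<sigma> by simp
    then obtain m where m: "m \<le> 2 * \<rho>" "(M, N) \<in> shear_step r \<rho> ^^ m"
      using shear_steps_connected MN by blast
    then obtain p where p: "awalk u p v" "length p = m"
      using shear_steps_awalk MN by blast
    have "\<mu> (\<lambda>_. 1) u v \<le> awalk_cost (\<lambda>_. 1) p"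
      by (rule min_cost_le_walk_cost[OF p(1)])
    also have "awalk_cost (\<lambda>_. 1) p = real m"
      using p(2) by (simp add: awalk_cost_def sum_list_triv)
    also have "ereal (real m) \<le> ereal (2 * real \<rho>)" using m(1) by simp
    finally show ?thesis .
  qed
  then show ?thesis unfolding graph_diameter_def by (intro SUP_least)
qed

text \<open>Together with the upper bound this makes the diameter a finite real, so
  \<open>real_of_ereal\<close> returns its true value.\<close>

lemma diameter_component_nonneg: "0 \<le> graph_diameter C"
proof -
  interpret wf_digraph C by (rule wf_component)
  have v: "pen base \<in> verts C" using base_in_rows by (simp add: verts_component)
  have "0 \<le> \<mu> (\<lambda>_. 1) (pen base) (pen base)"
    unfolding \<mu>_def by (intro INF_greatest) (simp add: pos_cost_pos_awalk_cost)
  also have "\<dots> \<le> graph_diameter C"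
    unfolding graph_diameter_def by (intro SUP_upper2[OF v] SUP_upper v)
  finally show ?thesis .
qed

text \<open>\<open>X\<close> is the annihilator of the kernel \<open>f2_space \<sigma>\<close> of
  the base tuple. A tuple has this kernel exactly if its rows lie in \<open>X\<close>, so
  independent tuples in a space of size \<open>2 ^ \<rho>\<close> are counted.\<close>

lemma card_W_set: "card (W_set r \<sigma>) = (\<Prod>i=1..\<rho>. 2 ^ (i - 1) * (2 ^ i - 1))"
proof -
  define X where "X = {c \<in> f2_space r. \<forall>i<\<sigma>. c i = 0}"
  have X: "F2.subspace X" "finite X" "X \<subseteq> f2_space r"
    by (auto simp: X_def f2_subspace_iff)
  have fiber_base: "fiber r base 0 = f2_space \<sigma>"
  proof -
    have "fiber r base 0 = vec_of_nat ` {0..2 ^ \<sigma> - 1}"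
      using fiber_unit_rows[of 0 \<rho> \<sigma>, folded r] unfolding vec_of_nat_0 by simp
    also have "{0..2 ^ \<sigma> - 1} = {..<2 ^ \<sigma> :: nat}" by (auto simp: Suc_le_eq le_diff_conv2)
    also have "vec_of_nat ` {..<2 ^ \<sigma>} = f2_space \<sigma>"
      using bij_betw_vec_of_nat by (simp add: bij_betw_def)
    finally show ?thesis .
  qed
  have "card X = 2 ^ \<rho>"
  proof -
    \<comment> \<open>As a set of vectors, \<open>X\<close> is the kernel of the first
      \<open>\<sigma>\<close> coordinate functionals.\<close>
    let ?E = "unit_rows 0 \<sigma>"
    have "f2_space \<sigma> \<subseteq> f2_space r" using r by (intro f2_space_mono) simp
    then have E: "?E \<in> indep_rows (f2_space r) \<sigma>"
      using unit_rows_indep[of 0 \<sigma>] by (auto simp: indep_rows_def)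
    have "app r ?E x = 0 \<longleftrightarrow> (\<forall>i<\<sigma>. x i = 0)" for x
      using r by (auto simp: app_def unit_rows_def dot_unit_vec fun_eq_iff)
    then have "fiber r ?E 0 = X" by (auto simp: fiber_def X_def)
    then show ?thesis using card_fiber[OF E, of 0] r by simp
  qed
  moreover have "W_set r \<sigma> = pen ` indep_rows X \<rho>"
  proof -
    have kernel: "fiber r M 0 = f2_space \<sigma> \<longleftrightarrow> M \<in> indep_rows X \<rho>" if M: "M \<in> rows" for M
    proof
      assume eq: "fiber r M 0 = f2_space \<sigma>"
      have "M k i = 0" if "i < \<sigma>" for k i
      proof -
        have "unit_vec i \<in> fiber r M 0" using that by (simp add: eq unit_vec_in_f2_space)
        then have "dot r (M k) (unit_vec i) = 0" by (simp add: fiber_def app_def fun_eq_iff)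
        then show ?thesis using that r by (simp add: dot_unit_vec)
      qed
      then show "M \<in> indep_rows X \<rho>" using M by (simp add: indep_rows_def X_def)
    next
      assume MX: "M \<in> indep_rows X \<rho>"
      have "f2_space \<sigma> \<subseteq> fiber r M 0"
      proof
        fix x assume x: "x \<in> f2_space \<sigma>"
        have "M k i * x i = 0" for k i
          using MX x by (cases "k < \<rho>"; cases "i < \<sigma>") (simp_all add: indep_rows_def X_def f2_space_def)
        then have "dot r (M k) x = 0" for k
          unfolding dot_def by (intro sum.neutral ballI)
        moreover have "x \<in> f2_space r" using x r f2_space_mono[of \<sigma> r] by auto
        ultimately show "x \<in> fiber r M 0" by (simp add: fiber_def app_def fun_eq_iff)
      qed
      then show "fiber r M 0 = f2_space \<sigma>"
        \<comment> \<open>Both sides have \<open>2 ^ \<sigma>\<close> elements, so the inclusion is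
          an equality.\<close>
        using card_fiber[OF M, of 0] r by (intro card_subset_eq[symmetric]) (simp_all add: card_f2_space)
    qed
    have "pen M ! 0 = pen base ! 0 \<longleftrightarrow> M \<in> indep_rows X \<rho>" if M: "M \<in> rows" for M
    proof -
      have "pen M ! 0 = pen base ! 0 \<longleftrightarrow> fiber r M 0 - {0} = fiber r base 0 - {0}"
        by (simp add: pencil_of_nth)
      also have "\<dots> \<longleftrightarrow> fiber r M 0 = fiber r base 0"
        by (metis insert_Diff zero_in_fiber_iff)
      finally show ?thesis using kernel[OF M] fiber_base by simp
    qed
    moreover have "indep_rows X \<rho> \<subseteq> rows" using X(3) by (auto simp: indep_rows_def)
    ultimately show ?thesis
      unfolding W_set_def verts_component base_pencil_eq_pen by blast
  qed
  moreover have "inj_on pen (indep_rows X \<rho>)"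
    using X(3) by (intro inj_on_subset[OF inj_on_pencil_of]) (auto simp: indep_rows_def)
  ultimately show ?thesis
    using card_indep_rows_eq[OF X(1,2), of 0 \<rho>] by (simp add: card_image)
qed

lemma common_degree_component:
  "common_degree C = 2 ^ (\<rho> - 1) * (2 ^ \<rho> - 1) * (2 ^ (\<sigma> + 1) - 1 - 1)"
  unfolding common_degree_def
proof (rule the_equality)
  show "regular_of_degree C (2 ^ (\<rho> - 1) * (2 ^ \<rho> - 1) * (2 ^ (\<sigma> + 1) - 1 - 1))"
    by (rule regular_component)
  fix d assume "regular_of_degree C d"
  \<comment> \<open>A vertex is needed for the degree to be unique.\<close>
  moreover have "pen base \<in> verts C" using base_in_rows by (simp add: verts_component)
  ultimately show "d = 2 ^ (\<rho> - 1) * (2 ^ \<rho> - 1) * (2 ^ (\<sigma> + 1) - 1 - 1)"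
    using regular_component unfolding regular_of_degree_def by metis
qed

lemma gauss_binomial2_mult:
  "real (card (verts C)) = gauss_binomial2 r \<sigma> * (\<Prod>i=1..\<rho>. 2 ^ (i - 1) * (2 ^ i - 1))"
proof -
  have "r - \<sigma> = \<rho>" by (simp add: r)
  then have "gauss_binomial2 r \<sigma> * (\<Prod>i=1..\<rho>. 2 ^ (i - 1) * (2 ^ i - 1)) =
      (\<Prod>i=1..\<rho>. (2 ^ (i + \<sigma>) - 1) / (2 ^ i - 1) * (2 ^ (i - 1) * (2 ^ i - 1 :: real)))"
    unfolding gauss_binomial2_def by (simp only: prod.distrib)
  also have "\<dots> = (\<Prod>i=1..\<rho>. 2 ^ (i - 1) * (2 ^ (i + \<sigma>) - 1))"
  proof (rule prod.cong)
    fix i assume "i \<in> {1..\<rho>}"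
    then have "1 < (2 :: real) ^ i" by (intro one_less_power) auto
    then show "(2 ^ (i + \<sigma>) - 1) / (2 ^ i - 1) * (2 ^ (i - 1) * (2 ^ i - 1 :: real)) =
        2 ^ (i - 1) * (2 ^ (i + \<sigma>) - 1)"
      by simp
  qed simp
  also have "\<dots> = real (card (verts C))"
    unfolding card_component by (simp add: of_nat_diff)
  finally show ?thesis by simp
qed

lemma card_component_le: "card (verts C) \<le> 2 ^ (r * \<rho>)"
proof -
  have "card (verts C) = card rows"
    unfolding verts_component by (rule card_image[OF inj_on_pencil_of])
  also have "\<dots> = (\<Prod>i<\<rho>. 2 ^ r - 2 ^ i)"
    using card_indep_rows[OF subspace_f2_space finite_f2_space, of r \<rho>] by (simp add: card_f2_space)
  also have "\<dots> \<le> (\<Prod>i<\<rho>. 2 ^ r)" by (rule prod_mono) simp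
  also have "\<dots> = 2 ^ (r * \<rho>)" by (simp add: power_mult)
  finally show ?thesis .
qed

end

section \<open>Bounds uniform in the admissible parameters\<close>

lemma admissible_pencil_parameters: "admissible r \<sigma> \<Longrightarrow> pencil_parameters r \<sigma> (r - \<sigma>)"
  by (auto simp: admissible_def pencil_parameters_def)

text \<open>With \<open>q = r - 1\<close> the exponent is at most \<open>5 * q + 5\<close>, and
  \<open>5 * q \<le> 7 + q ^ 2\<close> follows from \<open>(q - 2) * (q - 3) \<ge> 0\<close>; the
  constant 12 is 5 + 7.\<close>

lemma card_component_bound:
  assumes "admissible r \<sigma>"
  shows "card (verts (component_graph r \<sigma>)) \<le> 2 ^ 12 * 2 ^ ((r - 1) ^ 2)"
proof -
  interpret pencil_parameters r \<sigma> "r - \<sigma>"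
    by (rule admissible_pencil_parameters[OF assms])
  have \<rho>_le: "r - \<sigma> \<le> 5" using assms by (simp add: admissible_def)
  obtain q where q: "r = Suc q" using r \<sigma> by (cases r) auto
  have "5 * int q \<le> 7 + int q ^ 2"
  proof (cases "q \<le> 2")
    case True
    then have "q = 0 \<or> q = 1 \<or> q = 2" by linarith
    then show ?thesis by auto
  next
    case False
    have "0 \<le> (int q - 2) * (int q - 3)" using False by (intro mult_nonneg_nonneg) auto
    then show ?thesis by (simp add: power2_eq_square algebra_simps)
  qed
  then have "5 * q \<le> 7 + q ^ 2" by (simp flip: of_nat_power of_nat_le_iff[where 'a = int])
  moreover have "r * (r - \<sigma>) \<le> r * 5" using \<rho>_le by simp
  ultimately have "r * (r - \<sigma>) \<le> 12 + (r - 1) ^ 2" by (simp add: q)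
  then have "(2 :: nat) ^ (r * (r - \<sigma>)) \<le> 2 ^ (12 + (r - 1) ^ 2)" by (rule power_increasing) simp
  then show ?thesis
    using card_component_le by (simp only: power_add)
qed

text \<open>The exponents add up to \<open>r + \<rho>\<close>, at most
  \<open>r + 5 = 6 + (r - 1)\<close>.\<close>

lemma degree_bound:
  assumes "admissible r \<sigma>"
  shows "common_degree (component_graph r \<sigma>) \<le> 2 ^ 6 * 2 ^ (r - 1)"
proof -
  interpret pencil_parameters r \<sigma> "r - \<sigma>"
    by (rule admissible_pencil_parameters[OF assms])
  have \<rho>_le: "r - \<sigma> \<le> 5" using assms by (simp add: admissible_def)
  have "common_degree (component_graph r \<sigma>) \<le> 2 ^ (r - \<sigma> - 1) * 2 ^ (r - \<sigma>) * 2 ^ (\<sigma> + 1)"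
    unfolding common_degree_component by (intro mult_le_mono) simp_all
  also have "\<dots> = 2 ^ (r - \<sigma> - 1 + (r - \<sigma>) + (\<sigma> + 1))" by (simp only: power_add)
  also have "\<dots> \<le> 2 ^ (6 + (r - 1))" using r \<rho>_le by (intro power_increasing) linarith+
  finally show ?thesis by (simp only: power_add)
qed

lemma diameter_bound:
  assumes "admissible r \<sigma>"
  shows "graph_diameter (component_graph r \<sigma>) \<le> ereal (2 * real r - 2)"
    and "0 \<le> graph_diameter (component_graph r \<sigma>)"
proof -
  interpret pencil_parameters r \<sigma> "r - \<sigma>"
    by (rule admissible_pencil_parameters[OF assms])
  have "graph_diameter (component_graph r \<sigma>) \<le> ereal (2 * real (r - \<sigma>))"
    by (rule diameter_component_le)
  also have "2 * real (r - \<sigma>) \<le> 2 * real r - 2" using r \<sigma> by linarith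
  finally show "graph_diameter (component_graph r \<sigma>) \<le> ereal (2 * real r - 2)" by simp
  show "0 \<le> graph_diameter (component_graph r \<sigma>)"
    by (rule diameter_component_nonneg)
qed

theorem theorem5p8:
  shows
    "(\<forall>r \<sigma> \<rho> s t m\<^sub>1 :: nat.
        admissible r \<sigma> \<and> \<rho> = r - \<sigma> \<and> s = 2 ^ (\<rho> - 1) \<and> t = 2 ^ (\<sigma> + 1) - 1 \<and> m\<^sub>1 = 2 ^ \<rho> - 1 \<longrightarrow>
          card (W_set r \<sigma>) = (\<Prod>i=1..\<rho>. 2 ^ (i - 1) * (2 ^ i - 1)) \<and>
          card (verts (component_graph r \<sigma>)) = (\<Prod>i=1..\<rho>. 2 ^ (i - 1) * (2 ^ (i + \<sigma>) - 1)) \<and>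
          real (card (verts (component_graph r \<sigma>))) =
            gauss_binomial2 r \<sigma> * (\<Prod>i=1..\<rho>. 2 ^ (i - 1) * (2 ^ i - 1)) \<and>
          regular_of_degree (component_graph r \<sigma>) (s * m\<^sub>1 * (t - 1)) \<and>
          graph_diameter (component_graph r \<sigma>) \<le> ereal (2 * real r - 2))
     \<and> (\<lambda>(r, \<sigma>). real (card (verts (component_graph r \<sigma>))))
         \<in> O[principal {(r, \<sigma>). admissible r \<sigma>}](\<lambda>(r, \<sigma>). 2 ^ ((r - 1) ^ 2))
     \<and> (\<lambda>(r, \<sigma>). real (common_degree (component_graph r \<sigma>)))
         \<in> O[principal {(r, \<sigma>). admissible r \<sigma>}](\<lambda>(r, \<sigma>). 2 ^ (r - 1))
     \<and> (\<lambda>(r, \<sigma>). real_of_ereal (graph_diameter (component_graph r \<sigma>)))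
         \<in> O[principal {(r, \<sigma>). admissible r \<sigma>}](\<lambda>(r, \<sigma>). real (r - 1))"
proof (intro conjI allI impI)
  fix r \<sigma> \<rho> s t m\<^sub>1 :: nat
  assume "admissible r \<sigma> \<and> \<rho> = r - \<sigma> \<and> s = 2 ^ (\<rho> - 1) \<and> t = 2 ^ (\<sigma> + 1) - 1 \<and> m\<^sub>1 = 2 ^ \<rho> - 1"
  then have a: "admissible r \<sigma>" and \<rho>: "\<rho> = r - \<sigma>"
    and s: "s = 2 ^ (\<rho> - 1)" and t: "t = 2 ^ (\<sigma> + 1) - 1" and m: "m\<^sub>1 = 2 ^ \<rho> - 1"
    by simp_all
  interpret pencil_parameters r \<sigma> \<rho>
    unfolding \<rho> by (rule admissible_pencil_parameters[OF a])
  show "card (W_set r \<sigma>) = (\<Prod>i=1..\<rho>. 2 ^ (i - 1) * (2 ^ i - 1))"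
    by (rule card_W_set)
  show "card (verts (component_graph r \<sigma>)) = (\<Prod>i=1..\<rho>. 2 ^ (i - 1) * (2 ^ (i + \<sigma>) - 1))"
    by (rule card_component)
  show "real (card (verts (component_graph r \<sigma>))) =
      gauss_binomial2 r \<sigma> * (\<Prod>i=1..\<rho>. 2 ^ (i - 1) * (2 ^ i - 1))"
    by (rule gauss_binomial2_mult)
  show "regular_of_degree (component_graph r \<sigma>) (s * m\<^sub>1 * (t - 1))"
    unfolding s t m by (rule regular_component)
  show "graph_diameter (component_graph r \<sigma>) \<le> ereal (2 * real r - 2)"
    by (rule diameter_bound[OF a])
next
  \<comment> \<open>For a principal filter, an O-bound is a bound by one constant at all admissible
    pairs.\<close>
  have "real (card (verts (component_graph r \<sigma>))) \<le> 2 ^ 12 * 2 ^ ((r - 1) ^ 2)" if "admissible r \<sigma>" for r \<sigma>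
  proof -
    have "real (card (verts (component_graph r \<sigma>))) \<le> real (2 ^ 12 * 2 ^ ((r - 1) ^ 2))"
      unfolding of_nat_le_iff by (rule card_component_bound[OF that])
    then show ?thesis by simp
  qed
  then show "(\<lambda>(r, \<sigma>). real (card (verts (component_graph r \<sigma>))))
         \<in> O[principal {(r, \<sigma>). admissible r \<sigma>}](\<lambda>(r, \<sigma>). 2 ^ ((r - 1) ^ 2))"
    by (intro bigoI[of _ "2 ^ 12"]) (auto simp: eventually_principal)
next
  have "real (common_degree (component_graph r \<sigma>)) \<le> 2 ^ 6 * 2 ^ (r - 1)" if "admissible r \<sigma>" for r \<sigma>
  proof -
    have "real (common_degree (component_graph r \<sigma>)) \<le> real (2 ^ 6 * 2 ^ (r - 1))"
      unfolding of_nat_le_iff by (rule degree_bound[OF that])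
    then show ?thesis by simp
  qed
  then show "(\<lambda>(r, \<sigma>). real (common_degree (component_graph r \<sigma>)))
         \<in> O[principal {(r, \<sigma>). admissible r \<sigma>}](\<lambda>(r, \<sigma>). 2 ^ (r - 1))"
    by (intro bigoI[of _ "2 ^ 6"]) (auto simp: eventually_principal)
next
  have "\<bar>real_of_ereal (graph_diameter (component_graph r \<sigma>))\<bar> \<le> 2 * real (r - 1)"
    if a: "admissible r \<sigma>" for r \<sigma>
  proof -
    \<comment> \<open>The bounds from both sides exclude infinite values.\<close>
    obtain x where x: "graph_diameter (component_graph r \<sigma>) = ereal x"
      using diameter_bound[OF a] by (cases "graph_diameter (component_graph r \<sigma>)") auto
    have "0 \<le> x" "x \<le> 2 * real r - 2" using diameter_bound[OF a] by (simp_all add: x)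
    moreover have "1 \<le> r" using a by (auto simp: admissible_def)
    ultimately show ?thesis by (simp add: x of_nat_diff)
  qed
  then show "(\<lambda>(r, \<sigma>). real_of_ereal (graph_diameter (component_graph r \<sigma>)))
         \<in> O[principal {(r, \<sigma>). admissible r \<sigma>}](\<lambda>(r, \<sigma>). real (r - 1))"
    by (intro bigoI[of _ 2]) (auto simp: eventually_principal)
qed

end
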